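(* Let $(X,E,\ell)$ be a connected, locally finite, fully deterministic, symmetric labelled graph with finite label alphabet $\Sigma$ and root vertex $o\in X$. If $L_{o,o}(X)$ is a context-free language, then $X$ is a context-free graph with respect to $\{o\}$, and in particular the language $L_{o,o}(X)$ is deterministic context-free.
   Context: **Labelled graphs.** Let $\Sigma$ be a finite alphabet. A directed graph labelled by $\Sigma$ is a triple $(X,E,\ell)$, where $X$ is a finite or countable set of vertices, $E\subset X\times\Sigma\times X$ is the set of oriented labelled edges, and $\ell(x,a,y)=a$. An edge $(x,a,y)$ goes from $x$ to $y$ (loops, and multiple edges with different labels, are allowed). It is locally finite: every vertex is an endpoint of only finitely many edges. It is *fully deterministic* if at every vertex each $a\in\Sigma$ is the label of exactly one outgoing edge. It is *symmetric* if there is an involution $a\mapsto a^{-1}$ of $\Sigma$ with $a^{-1}\neq a$ for all $a$, such that $(x,a,y)\in E$ implies $(y,a^{-1},x)\in E$. The label of a path $e_1\cdots e_n$ (consecutive edges) is the word $\ell(e_1)\cdots\ell(e_n)\in\Sigma^*$; the empty path at a vertex has label the empty word $\epsilon$. $L_{x,y}(X)\subset\Sigma^*$ is the set of labels of all paths from $x$ to $y$. The graph is connected if any two vertices are joined by a path; $d(x,y)$ is the minimal length of a path from $x$ to $y$. **Context-free graphs.** For $n\ge 0$ let $B(o,n)=\{x: d(x,o)\le n\}$. The *cones* of $X$ with respect to $o$ are the connected components of the induced graphs $X\setminus B(o,n)$, $n\ge 0$. The boundary $\partial C$ of a cone $C$ is the set of vertices of $C$ having a neighbour outside $C$. $X$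 is *context-free with respect to $\{o\}$* if there are only finitely many isomorphism types of cones with respect to $o$, as labelled graphs with boundary (an isomorphism is a bijection of vertex sets $C\to C'$ that preserves labelled edges in both directions and maps $\partial C$ onto $\partial C'$). **Deterministic context-free languages.** A pushdown automaton is $(Q,\Sigma,Z,\delta,q_0,Q_f,z_0)$ with finite sets $Q$ (states), $\Sigma$ (input alphabet), $Z$ (stack symbols), $q_0\in Q$, $Q_f\subset Q$, $z_0\in Z$, and $\delta$ a map from $Q\times(\Sigma\cup\{\epsilon\})\times(Z\cup\{\epsilon\})$ to the finite subsets of $Q\times Z^*$. In state $p$, with top (rightmost) stack symbol $z$ (or $z=\epsilon$ if the stack is empty), it may choose $(q,\zeta')\in\delta(p,a,z)$, where $a$ is the next input letter, consume $a$, go to state $q$ and replace $z$ by $\zeta'$; or choose $(q,\zeta')\in\delta(p,\epsilon,z)$ and do the same without consuming input. A word is accepted if, starting in state $q_0$ with stack $z_0$, the automaton can reach after finitely many transitions a final state (in $Q_f$) with empty stack and with all input consumed. It is deterministic if $|\delta(p,a,z)|+|\delta(p,\epsilon,z)|\le 1$ for all $p\in Q$, $a\in\Sigma$, $z\in Z\cup\{\epsilon\}$. A language is context-free iff it is accepted by some pushdown automaton; a context-free language is *deterministic* if it is accepted by some deterministic pushdown automaton. *)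

theory Defs
  imports Main "HOL-Library.Countable_Set"
begin

section \<open>Labelled graphs\<close>

text \<open>The labelling function sends an edge \<open>(x, a, y)\<close> to its middle component, so it is not a
  separate field.\<close>

record ('v, 'a) lgraph =
  lg_alphabet :: "'a set"
  lg_verts :: "'v set"
  lg_edges :: "('v \<times> 'a \<times> 'v) set"

abbreviation lg_label :: "'v \<times> 'a \<times> 'v \<Rightarrow> 'a" where
  "lg_label e \<equiv> fst (snd e)"

definition labelled_graph :: "('v, 'a) lgraph \<Rightarrow> bool" where
  "labelled_graph G \<longleftrightarrow>
     finite (lg_alphabet G) \<and> countable (lg_verts G) \<and>
     lg_edges G \<subseteq> lg_verts G \<times> lg_alphabet G \<times> lg_verts G"

definition lg_locally_finite :: "('v, 'a) lgraph \<Rightarrow> bool" where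
  "lg_locally_finite G \<longleftrightarrow>
     (\<forall>x\<in>lg_verts G. finite {e \<in> lg_edges G. fst e = x \<or> snd (snd e) = x})"

definition lg_fully_deterministic :: "('v, 'a) lgraph \<Rightarrow> bool" where
  "lg_fully_deterministic G \<longleftrightarrow>
     (\<forall>x\<in>lg_verts G. \<forall>a\<in>lg_alphabet G. \<exists>!e. e \<in> lg_edges G \<and> fst e = x \<and> lg_label e = a)"

definition lg_symmetric :: "('v, 'a) lgraph \<Rightarrow> bool" where
  "lg_symmetric G \<longleftrightarrow>
     (\<exists>i. (\<forall>a\<in>lg_alphabet G. i a \<in> lg_alphabet G \<and> i (i a) = a \<and> i a \<noteq> a) \<and>
          (\<forall>x a y. (x, a, y) \<in> lg_edges G \<longrightarrow> (y, i a, x) \<in> lg_edges G))"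

inductive lg_path :: "('v, 'a) lgraph \<Rightarrow> 'v \<Rightarrow> ('v \<times> 'a \<times> 'v) list \<Rightarrow> 'v \<Rightarrow> bool"
  for G where
  Nil: "x \<in> lg_verts G \<Longrightarrow> lg_path G x [] x"
| Cons: "(x, a, y) \<in> lg_edges G \<Longrightarrow> lg_path G y es z \<Longrightarrow> lg_path G x ((x, a, y) # es) z"

definition lg_language :: "('v, 'a) lgraph \<Rightarrow> 'v \<Rightarrow> 'v \<Rightarrow> 'a list set" where
  "lg_language G x y = {map lg_label es | es. lg_path G x es y}"

definition lg_joined :: "('v, 'a) lgraph \<Rightarrow> 'v \<Rightarrow> 'v \<Rightarrow> bool" where
  "lg_joined G x y \<longleftrightarrow> (\<exists>es. lg_path G x es y)"

definition lg_connected :: "('v, 'a) lgraph \<Rightarrow> bool" where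
  "lg_connected G \<longleftrightarrow> (\<forall>x\<in>lg_verts G. \<forall>y\<in>lg_verts G. lg_joined G x y)"

text \<open>Only meaningful when \<open>x\<close> and \<open>y\<close> are joined by a path.\<close>

definition lg_dist :: "('v, 'a) lgraph \<Rightarrow> 'v \<Rightarrow> 'v \<Rightarrow> nat" where
  "lg_dist G x y = (LEAST n. \<exists>es. lg_path G x es y \<and> length es = n)"


section \<open>Context-free graphs\<close>

definition lg_ball :: "('v, 'a) lgraph \<Rightarrow> 'v \<Rightarrow> nat \<Rightarrow> 'v set" where
  "lg_ball G r n = {x \<in> lg_verts G. lg_dist G x r \<le> n}"

definition lg_induced :: "('v, 'a) lgraph \<Rightarrow> 'v set \<Rightarrow> ('v, 'a) lgraph" where
  "lg_induced G V =
     G\<lparr>lg_verts := V, lg_edges := {(x, a, y) \<in> lg_edges G. x \<in> V \<and> y \<in> V}\<rparr>"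

text \<open>For a symmetric graph the two directions in this definition are equivalent; requiring both
  makes the relation an equivalence on the vertex set of any graph.\<close>

definition lg_components :: "('v, 'a) lgraph \<Rightarrow> 'v set set" where
  "lg_components G =
     lg_verts G // {(x, y). x \<in> lg_verts G \<and> y \<in> lg_verts G \<and> lg_joined G x y \<and> lg_joined G y x}"

definition lg_cones :: "('v, 'a) lgraph \<Rightarrow> 'v \<Rightarrow> 'v set set" where
  "lg_cones G r = (\<Union>n. lg_components (lg_induced G (lg_verts G - lg_ball G r n)))"

definition lg_neighbour :: "('v, 'a) lgraph \<Rightarrow> 'v \<Rightarrow> 'v \<Rightarrow> bool" where
  "lg_neighbour G x y \<longleftrightarrow> (\<exists>a. (x, a, y) \<in> lg_edges G \<or> (y, a, x) \<in> lg_edges G)"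

definition lg_boundary :: "('v, 'a) lgraph \<Rightarrow> 'v set \<Rightarrow> 'v set" where
  "lg_boundary G C = {x \<in> C. \<exists>y \<in> lg_verts G - C. lg_neighbour G x y}"

definition lg_cone_iso :: "('v, 'a) lgraph \<Rightarrow> 'v set \<Rightarrow> 'v set \<Rightarrow> bool" where
  "lg_cone_iso G C C' \<longleftrightarrow>
     (\<exists>f. bij_betw f C C' \<and>
          (\<forall>x\<in>C. \<forall>y\<in>C. \<forall>a. (x, a, y) \<in> lg_edges G \<longleftrightarrow> (f x, a, f y) \<in> lg_edges G) \<and>
          f ` lg_boundary G C = lg_boundary G C')"

definition context_free_graph :: "('v, 'a) lgraph \<Rightarrow> 'v \<Rightarrow> bool" where
  "context_free_graph G r \<longleftrightarrow>
     finite (lg_cones G r //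
       {(C, C'). C \<in> lg_cones G r \<and> C' \<in> lg_cones G r \<and> lg_cone_iso G C C'})"


section \<open>Pushdown automata\<close>

text \<open>In \<open>pda_trans M p a z\<close> the value \<open>None\<close> stands for the empty word, both for the input letter
  \<open>a\<close> and for the stack symbol \<open>z\<close>. Only the values on the domain described in \<open>pda\<close> matter.\<close>

record ('q, 'a, 'z) pda =
  pda_states :: "'q set"
  pda_input :: "'a set"
  pda_stack :: "'z set"
  pda_trans :: "'q \<Rightarrow> 'a option \<Rightarrow> 'z option \<Rightarrow> ('q \<times> 'z list) set"
  pda_init :: 'q
  pda_finals :: "'q set"
  pda_start :: 'z

definition pda :: "('q, 'a, 'z) pda \<Rightarrow> bool" where
  "pda M \<longleftrightarrow>
     finite (pda_states M) \<and> finite (pda_input M) \<and> finite (pda_stack M) \<and>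
     pda_init M \<in> pda_states M \<and> pda_finals M \<subseteq> pda_states M \<and> pda_start M \<in> pda_stack M \<and>
     (\<forall>p \<in> pda_states M. \<forall>a \<in> insert None (Some ` pda_input M).
      \<forall>z \<in> insert None (Some ` pda_stack M).
        finite (pda_trans M p a z) \<and>
        pda_trans M p a z \<subseteq> pda_states M \<times> lists (pda_stack M))"

text \<open>The top of the stack is the last element of the list; transitions for \<open>None\<close> in the stack
  argument apply only when the stack is empty.\<close>

definition pda_top :: "'z list \<Rightarrow> 'z option" where
  "pda_top s = (if s = [] then None else Some (last s))"

text \<open>A configuration consists of the state, the remaining input and the stack. Recall that
  \<open>butlast [] = []\<close>.\<close>

inductive pda_step ::
  "('q, 'a, 'z) pda \<Rightarrow> 'q \<times> 'a list \<times> 'z list \<Rightarrow> 'q \<times> 'a list \<times> 'z list \<Rightarrow> bool"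
  for M where
  read: "(q, t) \<in> pda_trans M p (Some a) (pda_top s) \<Longrightarrow>
           pda_step M (p, a # w, s) (q, w, butlast s @ t)"
| silent: "(q, t) \<in> pda_trans M p None (pda_top s) \<Longrightarrow>
           pda_step M (p, w, s) (q, w, butlast s @ t)"

definition pda_language :: "('q, 'a, 'z) pda \<Rightarrow> 'a list set" where
  "pda_language M =
     {w \<in> lists (pda_input M).
        \<exists>q \<in> pda_finals M. (pda_step M)\<^sup>*\<^sup>* (pda_init M, w, [pda_start M]) (q, [], [])}"

definition pda_deterministic :: "('q, 'a, 'z) pda \<Rightarrow> bool" where
  "pda_deterministic M \<longleftrightarrow>
     (\<forall>p \<in> pda_states M. \<forall>a \<in> pda_input M. \<forall>z \<in> insert None (Some ` pda_stack M).
        card (pda_trans M p (Some a) z) + card (pda_trans M p None z) \<le> 1)"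

text \<open>The sets of states and of stack symbols are finite, so up to renaming they are sets of
  natural numbers.\<close>

definition context_free_language :: "'a set \<Rightarrow> 'a list set \<Rightarrow> bool" where
  "context_free_language \<Sigma> L \<longleftrightarrow>
     (\<exists>M :: (nat, 'a, nat) pda. pda M \<and> pda_input M = \<Sigma> \<and> pda_language M = L)"

definition det_context_free_language :: "'a set \<Rightarrow> 'a list set \<Rightarrow> bool" where
  "det_context_free_language \<Sigma> L \<longleftrightarrow>
     (\<exists>M :: (nat, 'a, nat) pda.
        pda M \<and> pda_deterministic M \<and> pda_input M = \<Sigma> \<and> pda_language M = L)"

end

theory Submission
  imports Defs
begin

text \<open>By symmetry and determinism words act on the vertices like elements of a group, and the
  language at the root \<open>r\<close> is the stabiliser of \<open>r\<close>. Let \<open>F\<close> be the finite family of languages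
  derived from the variables of a binary grammar of that language; all words of a member of \<open>F\<close>
  used in a derivation join the same two vertices, so these two vertices are at distance at most
  some \<open>K\<close>. If \<open>u\<close> labels a path inside a cone between boundary vertices \<open>x\<close> and \<open>y\<close>, and \<open>\<alpha>\<close>, \<open>\<beta>\<close>
  are geodesics from \<open>r\<close> to \<open>x\<close> and from \<open>y\<close> to \<open>r\<close>, then the smallest subtree of \<open>\<alpha> u \<beta>\<close> that covers
  \<open>u\<close> splits at a vertex of the cone, whose distance from \<open>r\<close> forces the subtree to extend over at
  most \<open>K\<close> letters of \<open>\<alpha>\<close> and of \<open>\<beta>\<close>. Hence the boundary has diameter at most \<open>3 K\<close>, and whether \<open>u\<close>
  leads from \<open>x\<close> to \<open>y\<close> is determined by which members of \<open>F\<close> join which vertices near \<open>x\<close>. Together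
  with the edges leaving the cone, this finite information determines the cone up to isomorphism.\<close>

section \<open>Binary grammars\<close>

inductive gen :: "('n \<times> 'a list) set \<Rightarrow> ('n \<times> 'n \<times> 'n) set \<Rightarrow> 'n \<Rightarrow> 'a list \<Rightarrow> bool"
  for U P where
  gen_unit: "(A, w) \<in> U \<Longrightarrow> gen U P A w"
| gen_bin: "(A, B, C) \<in> P \<Longrightarrow> gen U P B u \<Longrightarrow> gen U P C v \<Longrightarrow> gen U P A (u @ v)"

text \<open>The factorisation of \<open>\<alpha> u \<beta>\<close> at the lowest node of the parse tree covering \<open>u\<close>.\<close>

definition splits :: "'a list set set \<Rightarrow> 'a list set \<Rightarrow> 'a list \<Rightarrow> 'a list \<Rightarrow> 'a list \<Rightarrow> bool" where
  "splits F L \<alpha> u \<beta> \<longleftrightarrow>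
     (\<exists>T \<alpha>' s t \<beta>'. T \<in> F \<and> \<alpha> = \<alpha>' @ s \<and> \<beta> = t @ \<beta>' \<and> s @ u @ t \<in> T \<and>
        (\<forall>v\<in>T. \<alpha>' @ v @ \<beta>' \<in> L) \<and>
        (length s \<le> 1 \<and> length t \<le> 1 \<or>
         (\<exists>B C u\<^sub>1 u\<^sub>2. B \<in> F \<and> C \<in> F \<and> u = u\<^sub>1 @ u\<^sub>2 \<and> s @ u\<^sub>1 \<in> B \<and> u\<^sub>2 @ t \<in> C \<and>
            (\<forall>v\<in>B. \<alpha>' @ v @ u\<^sub>2 @ t @ \<beta>' \<in> L) \<and>
            (\<forall>v\<in>C. \<alpha>' @ s @ u\<^sub>1 @ v @ \<beta>' \<in> L))))"

text \<open>Climbing back up a parse tree only enlarges the context: \<open>\<alpha>'\<close> and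
  \<open>\<beta>'\<close> absorb \<open>x\<close> and \<open>y\<close>, while \<open>T\<close>,
  \<open>s\<close>, \<open>t\<close> and the cut of \<open>u\<close> are kept.\<close>

lemma splits_context:
  assumes "splits F L \<alpha> u \<beta>" and "\<And>v. v \<in> L \<Longrightarrow> x @ v @ y \<in> L'"
  shows "splits F L' (x @ \<alpha>) u (\<beta> @ y)"
proof -
  from assms(1) obtain T \<alpha>' s t \<beta>' where
    *: "T \<in> F" "\<alpha> = \<alpha>' @ s" "\<beta> = t @ \<beta>'" "s @ u @ t \<in> T" "\<forall>v\<in>T. \<alpha>' @ v @ \<beta>' \<in> L"
    and alt: "length s \<le> 1 \<and> length t \<le> 1 \<or>
         (\<exists>B C u\<^sub>1 u\<^sub>2. B \<in> F \<and> C \<in> F \<and> u = u\<^sub>1 @ u\<^sub>2 \<and> s @ u\<^sub>1 \<in> B \<and> u\<^sub>2 @ t \<in> C \<and>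
            (\<forall>v\<in>B. \<alpha>' @ v @ u\<^sub>2 @ t @ \<beta>' \<in> L) \<and>
            (\<forall>v\<in>C. \<alpha>' @ s @ u\<^sub>1 @ v @ \<beta>' \<in> L))"
    unfolding splits_def by blast
  have tr: "(x @ \<alpha>') @ v @ (\<beta>' @ y) \<in> L'" if "\<alpha>' @ v @ \<beta>' \<in> L" for v
    using assms(2)[OF that] by simp
  have "length s \<le> 1 \<and> length t \<le> 1 \<or>
         (\<exists>B C u\<^sub>1 u\<^sub>2. B \<in> F \<and> C \<in> F \<and> u = u\<^sub>1 @ u\<^sub>2 \<and> s @ u\<^sub>1 \<in> B \<and> u\<^sub>2 @ t \<in> C \<and>
            (\<forall>v\<in>B. (x @ \<alpha>') @ v @ u\<^sub>2 @ t @ (\<beta>' @ y) \<in> L') \<and>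
            (\<forall>v\<in>C. (x @ \<alpha>') @ s @ u\<^sub>1 @ v @ (\<beta>' @ y) \<in> L'))"
    using alt
  proof
    assume "\<exists>B C u\<^sub>1 u\<^sub>2. B \<in> F \<and> C \<in> F \<and> u = u\<^sub>1 @ u\<^sub>2 \<and> s @ u\<^sub>1 \<in> B \<and> u\<^sub>2 @ t \<in> C \<and>
            (\<forall>v\<in>B. \<alpha>' @ v @ u\<^sub>2 @ t @ \<beta>' \<in> L) \<and>
            (\<forall>v\<in>C. \<alpha>' @ s @ u\<^sub>1 @ v @ \<beta>' \<in> L)"
    then obtain B C u1 u2 where
      **: "B \<in> F" "C \<in> F" "u = u1 @ u2" "s @ u1 \<in> B" "u2 @ t \<in> C"
        "\<forall>v\<in>B. \<alpha>' @ v @ u2 @ t @ \<beta>' \<in> L" "\<forall>v\<in>C. \<alpha>' @ s @ u1 @ v @ \<beta>' \<in> L"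
      by blast
    have "\<forall>v\<in>B. (x @ \<alpha>') @ v @ u2 @ t @ (\<beta>' @ y) \<in> L'"
      using tr[of "_ @ u2 @ t"] **(6) by simp
    moreover have "\<forall>v\<in>C. (x @ \<alpha>') @ s @ u1 @ v @ (\<beta>' @ y) \<in> L'"
      using tr[of "s @ u1 @ _"] **(7) by simp
    ultimately show ?thesis using **(1-5) by blast
  qed blast
  moreover have "x @ \<alpha> = (x @ \<alpha>') @ s" "\<beta> @ y = t @ (\<beta>' @ y)" using * by simp_all
  moreover have "\<forall>v\<in>T. (x @ \<alpha>') @ v @ (\<beta>' @ y) \<in> L'" using tr *(5) by blast
  ultimately show ?thesis using *(1,4) unfolding splits_def by blast
qed

text \<open>Induction on the derivation. If \<open>u\<close> lies inside the word of one child, the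
  factorisation found there is used and the sibling's word joins the context. If \<open>u\<close>
  straddles the cut, or the node is terminal, the node itself provides \<open>T\<close>, with
  \<open>\<alpha>'\<close> and \<open>\<beta>'\<close> empty.\<close>

lemma gen_splits:
  assumes "gen U P A w" "w = \<alpha> @ u @ \<beta>" "A \<in> N"
    and P: "\<And>A B C. (A, B, C) \<in> P \<Longrightarrow> A \<in> N \<Longrightarrow> B \<in> N \<and> C \<in> N"
    and U: "\<And>A w. (A, w) \<in> U \<Longrightarrow> length w \<le> 1"
  shows "splits ((\<lambda>A. Collect (gen U P A)) ` N) (Collect (gen U P A)) \<alpha> u \<beta>"
  using assms(1-3)
proof (induction arbitrary: \<alpha> u \<beta>)
  case (gen_unit A w)
  have "length \<alpha> \<le> 1" "length \<beta> \<le> 1" using U[OF gen_unit(1)] gen_unit(2) by auto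
  moreover have "gen U P A (\<alpha> @ u @ \<beta>)" using gen_unit gen.gen_unit by metis
  ultimately show ?case
    unfolding splits_def using gen_unit(3)
    by (intro exI[of _ "Collect (gen U P A)"] exI[of _ "[]"] exI[of _ \<alpha>] exI[of _ \<beta>]) auto
next
  case (gen_bin A B C w1 w2)
  have BC: "B \<in> N" "C \<in> N" using P gen_bin by blast+
  consider z where "w1 = \<alpha> @ u @ z" "\<beta> = z @ w2" | z where "w2 = z @ u @ \<beta>" "\<alpha> = w1 @ z"
    | u1 u2 where "u = u1 @ u2" "w1 = \<alpha> @ u1" "w2 = u2 @ \<beta>"
    using gen_bin.prems(1) by (auto simp: append_eq_append_conv2)
  then show ?case
  proof cases
    case 1
    have "splits ((\<lambda>A. Collect (gen U P A)) ` N) (Collect (gen U P A)) ([] @ \<alpha>) u (z @ w2)"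
      by (rule splits_context[OF gen_bin.IH(1)[OF 1(1) BC(1)]]) (use gen_bin.hyps gen.gen_bin in force)
    then show ?thesis using 1 by simp
  next
    case 2
    have "splits ((\<lambda>A. Collect (gen U P A)) ` N) (Collect (gen U P A)) (w1 @ z) u (\<beta> @ [])"
      by (rule splits_context[OF gen_bin.IH(2)[OF 2(1) BC(2)]]) (use gen_bin.hyps gen.gen_bin in force)
    then show ?thesis using 2 by simp
  next
    case 3
    have 1: "gen U P A (v @ u2 @ \<beta>)" if "gen U P B v" for v
      using gen_bin.hyps gen.gen_bin[OF gen_bin.hyps(1) that] 3 by simp
    have 2: "gen U P A (\<alpha> @ u1 @ v)" if "gen U P C v" for v
      using gen.gen_bin[OF gen_bin.hyps(1) _ that, of "\<alpha> @ u1"] gen_bin.hyps 3 by simp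
    have "\<exists>B C u\<^sub>1 u\<^sub>2. B \<in> (\<lambda>A. Collect (gen U P A)) ` N \<and> C \<in> (\<lambda>A. Collect (gen U P A)) ` N \<and>
        u = u\<^sub>1 @ u\<^sub>2 \<and> \<alpha> @ u\<^sub>1 \<in> B \<and> u\<^sub>2 @ \<beta> \<in> C \<and>
        (\<forall>v\<in>B. [] @ v @ u\<^sub>2 @ \<beta> @ [] \<in> Collect (gen U P A)) \<and>
        (\<forall>v\<in>C. [] @ \<alpha> @ u\<^sub>1 @ v @ [] \<in> Collect (gen U P A))"
      using 1 2 3 gen_bin.hyps BC
      by (intro exI[of _ "Collect (gen U P B)"] exI[of _ "Collect (gen U P C)"])
        (rule exI[of _ u1], rule exI[of _ u2], auto)
    moreover have "gen U P A (\<alpha> @ u @ \<beta>)"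
      using gen.gen_bin[OF gen_bin.hyps] gen_bin.prems by simp
    ultimately show ?thesis
      unfolding splits_def using gen_bin.prems(2)
      by (intro exI[of _ "Collect (gen U P A)"])
        (rule exI[of _ "[]"], rule exI[of _ \<alpha>], rule exI[of _ \<beta>], rule exI[of _ "[]"], auto)
  qed
qed

section \<open>The grammar of a pushdown automaton\<close>

text \<open>\<open>Pops b p s q\<close> derives the words along which \<open>M\<close> gets from state \<open>p\<close> to state \<open>q\<close> while
  removing \<open>s\<close> from the top of the stack; \<open>b\<close> says whether \<open>s\<close> is the whole stack, so that
  transitions for the empty stack are available.\<close>

datatype ('q, 'a, 'z) nonterm =
  Letter "'a option"
| Pop 'q 'z 'q
| Pops bool 'q "'z list" 'q

text \<open>\<open>Letter\<close> makes an optional input letter into a nonterminal, so that reading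
  and silent transitions alike give productions with exactly two nonterminals on the right.\<close>

inductive_set pda_units :: "(('q, 'a, 'z) nonterm \<times> 'a list) set" where
  "(Letter None, []) \<in> pda_units"
| "(Letter (Some a), [a]) \<in> pda_units"
| "(Pops b p [] p, []) \<in> pda_units"

text \<open>The triple construction, with guessed intermediate states. The third rule strips the
  right end of the word because the top of the stack is the last element. Transitions on the empty
  stack enter only through the first rule, where nothing lies below.\<close>

inductive_set pda_prods ::
  "('q, 'a, 'z) pda \<Rightarrow>
     (('q, 'a, 'z) nonterm \<times> ('q, 'a, 'z) nonterm \<times> ('q, 'a, 'z) nonterm) set"
  for M where
  "(r, t) \<in> pda_trans M p a None \<Longrightarrow> a \<in> insert None (Some ` pda_input M) \<Longrightarrow>
     (Pops True p [] q, Letter a, Pops True r t q) \<in> pda_prods M"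
| "(r, t) \<in> pda_trans M p a (Some z) \<Longrightarrow> a \<in> insert None (Some ` pda_input M) \<Longrightarrow>
     (Pop p z q, Letter a, Pops False r t q) \<in> pda_prods M"
| "r \<in> pda_states M \<Longrightarrow> (Pops b p (s @ [z]) q, Pop p z r, Pops b r s q) \<in> pda_prods M"

abbreviation pda_gen :: "('q, 'a, 'z) pda \<Rightarrow> ('q, 'a, 'z) nonterm \<Rightarrow> 'a list \<Rightarrow> bool" where
  "pda_gen M \<equiv> gen pda_units (pda_prods M)"

text \<open>The semantic invariant for soundness. Quantifying over the remaining input
  \<open>v\<close> and the lower stack \<open>s\<close> is what lets the runs of two children be
  concatenated.\<close>

primrec runs :: "('q, 'a, 'z) pda \<Rightarrow> ('q, 'a, 'z) nonterm \<Rightarrow> 'a list \<Rightarrow> bool" where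
  "runs M (Letter a) w \<longleftrightarrow> w = (case a of None \<Rightarrow> [] | Some b \<Rightarrow> [b])"
| "runs M (Pop p z q) w \<longleftrightarrow> (\<forall>v s. (pda_step M)\<^sup>*\<^sup>* (p, w @ v, s @ [z]) (q, v, s))"
| "runs M (Pops b p t q) w \<longleftrightarrow>
     (\<forall>v s. (b \<longrightarrow> s = []) \<longrightarrow> (pda_step M)\<^sup>*\<^sup>* (p, w @ v, s @ t) (q, v, s))"

lemma pda_step_letter:
  assumes "(r, t) \<in> pda_trans M p a (pda_top s)" "runs M (Letter a) u"
  shows "pda_step M (p, u @ v, s) (r, v, butlast s @ t)"
  using assms by (cases a) (auto intro: pda_step.intros)

lemma pda_gen_sound:
  "pda_gen M A w \<Longrightarrow> runs M A w"
proof (induction rule: gen.induct)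
  case (gen_unit A w)
  then show ?case by (cases rule: pda_units.cases) auto
next
  case (gen_bin A B C u v)
  from gen_bin(1) show ?case
  proof (cases rule: pda_prods.cases)
    case (1 r t p a q)
    have "pda_step M (p, u @ v @ v', []) (r, v @ v', t)" for v'
      using pda_step_letter[of r t M p a "[]" u "v @ v'"] 1 gen_bin.IH by (simp add: pda_top_def)
    moreover have "(pda_step M)\<^sup>*\<^sup>* (r, v @ v', t) (q, v', [])" for v'
      using 1 gen_bin.IH by force
    ultimately have "(pda_step M)\<^sup>*\<^sup>* (p, u @ v @ v', []) (q, v', [])" for v'
      by (rule converse_rtranclp_into_rtranclp)
    then show ?thesis unfolding 1(1) by simp
  next
    case (2 r t p a z q)
    have "pda_step M (p, u @ v @ v', s @ [z]) (r, v @ v', s @ t)" for s v'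
      using pda_step_letter[of r t M p a "s @ [z]" u "v @ v'"] 2 gen_bin.IH
      by (simp add: pda_top_def)
    moreover have "(pda_step M)\<^sup>*\<^sup>* (r, v @ v', s @ t) (q, v', s)" for v' s
      using 2 gen_bin.IH by force
    ultimately have "(pda_step M)\<^sup>*\<^sup>* (p, u @ v @ v', s @ [z]) (q, v', s)" for v' s
      by (rule converse_rtranclp_into_rtranclp)
    then show ?thesis unfolding 2(1) by simp
  next
    case (3 r b p s z q)
    have "(pda_step M)\<^sup>*\<^sup>* (p, u @ v', s' @ [z]) (r, v', s')" for v' s'
      using 3 gen_bin.IH(1) by simp
    from this[of "v @ _" "_ @ s"]
    have 1: "(pda_step M)\<^sup>*\<^sup>* (p, u @ v @ v', s' @ s @ [z]) (r, v @ v', s' @ s)" for v' s'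
      by simp
    have 2: "(pda_step M)\<^sup>*\<^sup>* (r, v @ v', s' @ s) (q, v', s')" if "b \<longrightarrow> s' = []" for v' s'
      using that 3 gen_bin.IH(2) by simp
    have "(pda_step M)\<^sup>*\<^sup>* (p, (u @ v) @ v', s' @ s @ [z]) (q, v', s')" if "b \<longrightarrow> s' = []" for v' s'
      using rtranclp_trans[OF 1 2[OF that]] by simp
    then show ?thesis unfolding 3(1) runs.simps by blast
  qed
qed

lemma pda_gen_Pops_snocE:
  assumes "pda_gen M (Pops b p (s @ [z]) q) w"
  obtains u v r where "w = u @ v" "r \<in> pda_states M" "pda_gen M (Pop p z r) u"
    "pda_gen M (Pops b r s q) v"
  using assms
proof cases
  case gen_unit
  then show ?thesis by (cases rule: pda_units.cases) auto
next
  case (gen_bin B C u v)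
  from gen_bin(2) show ?thesis
    by (cases rule: pda_prods.cases) (use gen_bin that in auto)
qed

text \<open>A transition pushes a whole word \<open>t\<close> onto what is left of the old stack, so
  a derivation for \<open>s @ t\<close> has to be cut where exactly \<open>t\<close> is gone.
  Symbols come off at the right, hence the reverse induction on \<open>t\<close>.\<close>

lemma pda_gen_Pops_append:
  assumes "pda_gen M (Pops b p (s @ t) q) w" "p \<in> pda_states M"
  shows "\<exists>u v r. w = u @ v \<and> r \<in> pda_states M \<and> pda_gen M (Pops False p t r) u \<and>
           pda_gen M (Pops b r s q) v"
  using assms
proof (induction t arbitrary: p w rule: rev_induct)
  case Nil
  then show ?case
    by (intro exI[of _ "[]"] exI[of _ w] exI[of _ p]) (auto intro: gen_unit pda_units.intros)
next
  case (snoc z t)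
  have "pda_gen M (Pops b p ((s @ t) @ [z]) q) w" using snoc.prems(1) by simp
  then obtain u v r where *: "w = u @ v" "r \<in> pda_states M"
    "pda_gen M (Pop p z r) u" "pda_gen M (Pops b r (s @ t) q) v"
    by (rule pda_gen_Pops_snocE)
  from snoc.IH[OF *(4) *(2)] obtain u' v' r' where
    "v = u' @ v'" "r' \<in> pda_states M" "pda_gen M (Pops False r t r') u'"
    "pda_gen M (Pops b r' s q) v'" by blast
  moreover from this have "pda_gen M (Pops False p (t @ [z]) r') (u @ u')"
    using gen_bin[OF pda_prods.intros(3)[OF *(2)] *(3)] by blast
  ultimately show ?case using *
    by (intro exI[of _ "u @ u'"] exI[of _ v'] exI[of _ r']) auto
qed

text \<open>Induction from the first step of the run. If the stack has top \<open>z\<close>, the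
  hypothesis derives the removal of the pushed word together with the rest; cutting it after the
  pushed word yields a derivation of a \<open>Pop\<close> of \<open>z\<close>.\<close>

lemma pda_gen_complete:
  assumes "pda M" "(pda_step M)\<^sup>*\<^sup>* (p, w, s) (q, [], [])"
    "p \<in> pda_states M" "w \<in> lists (pda_input M)" "s \<in> lists (pda_stack M)"
  shows "pda_gen M (Pops True p s q) w"
  using assms(2-5)
proof (induction "(p, w, s)" arbitrary: p w s rule: converse_rtranclp_induct)
  case base
  then show ?case by (auto intro: gen_unit pda_units.intros)
next
  case (step y)
  from step(1) obtain a p' t u w' where
    *: "y = (p', w', butlast s @ t)" "(p', t) \<in> pda_trans M p a (pda_top s)" "w = u @ w'"
      "runs M (Letter a) u" "a \<in> insert None (Some ` pda_input M)"
    using step.prems by (cases rule: pda_step.cases) force+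
  have top: "pda_top s \<in> insert None (Some ` pda_stack M)"
    using step.prems by (auto simp: pda_top_def)
  have "(p', t) \<in> pda_states M \<times> lists (pda_stack M)"
    using assms(1) * top step.prems unfolding pda_def by blast
  then have p': "p' \<in> pda_states M" "t \<in> lists (pda_stack M)" by auto
  have "butlast s \<in> lists (pda_stack M)" using step.prems by (auto dest: in_set_butlastD)
  then have IH: "pda_gen M (Pops True p' (butlast s @ t) q) w'"
    using step.hyps(3)[of p' w' "butlast s @ t"] * p' step.prems by auto
  have L: "pda_gen M (Letter a) u"
    using * by (cases a) (auto intro: gen_unit pda_units.intros)
  show ?case
  proof (cases s rule: rev_cases)
    case Nil
    then show ?thesis using *(1,2,3,5) IH gen_bin[OF pda_prods.intros(1) L] by (simp add: pda_top_def)
  next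
    case (snoc s' z)
    obtain x y r where **: "w' = x @ y" "r \<in> pda_states M" "pda_gen M (Pops False p' t r) x"
      "pda_gen M (Pops True r s' q) y"
      using pda_gen_Pops_append[of M True p' s' t q w'] IH p' snoc by auto
    have "(p', t) \<in> pda_trans M p a (Some z)" using *(2) snoc by (simp add: pda_top_def)
    from gen_bin[OF pda_prods.intros(2)[OF this *(5)] L **(3)]
    have "pda_gen M (Pops True p (s' @ [z]) q) ((u @ x) @ y)"
      by (rule gen_bin[OF pda_prods.intros(3)[OF **(2)] _ **(4)])
    then show ?thesis using * ** snoc by simp
  qed
qed

section \<open>A finite set of nonterminals closed under the productions\<close>

definition pda_words :: "('q, 'a, 'z) pda \<Rightarrow> 'z list set" where
  "pda_words M = insert [pda_start M] (\<Union>p\<in>pda_states M.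
     \<Union>a\<in>insert None (Some ` pda_input M). \<Union>z\<in>insert None (Some ` pda_stack M).
       snd ` pda_trans M p a z)"

text \<open>All prefixes of pushed words occur because the productions shorten the argument of
  \<open>Pops\<close> at its right end.\<close>

definition pda_nonterms :: "('q, 'a, 'z) pda \<Rightarrow> ('q, 'a, 'z) nonterm set" where
  "pda_nonterms M =
     Letter ` insert None (Some ` pda_input M) \<union>
     (\<lambda>(p, z, q). Pop p z q) ` (pda_states M \<times> pda_stack M \<times> pda_states M) \<union>
     (\<lambda>(b, p, s, q). Pops b p s q) `
       (UNIV \<times> pda_states M \<times> (\<Union>t\<in>pda_words M. (\<lambda>n. take n t) ` {..length t}) \<times> pda_states M)"

lemma pda_words_lists:
  assumes M: "pda M" and "t \<in> pda_words M"
  shows "t \<in> lists (pda_stack M)"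
proof -
  consider "t = [pda_start M]" | p a z y where "t = snd y" "y \<in> pda_trans M p a z"
    "p \<in> pda_states M" "a \<in> insert None (Some ` pda_input M)"
    "z \<in> insert None (Some ` pda_stack M)"
    using assms(2) unfolding pda_words_def by blast
  then show ?thesis
  proof cases
    case 1
    then show ?thesis using M by (simp add: pda_def)
  next
    case 2
    then have "y \<in> pda_states M \<times> lists (pda_stack M)" using M unfolding pda_def by blast
    then show ?thesis using 2(1) by auto
  qed
qed

lemma finite_pda_nonterms: "pda M \<Longrightarrow> finite (pda_nonterms M)"
  unfolding pda_nonterms_def pda_words_def pda_def by auto

lemma Pops_pda_nonterms:
  "Pops b p s q \<in> pda_nonterms M \<longleftrightarrow>
     p \<in> pda_states M \<and> q \<in> pda_states M \<and> (\<exists>t. s @ t \<in> pda_words M)"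
proof -
  have "s \<in> (\<Union>t\<in>pda_words M. (\<lambda>n. take n t) ` {..length t}) \<longleftrightarrow> (\<exists>t. s @ t \<in> pda_words M)"
    (is "?l \<longleftrightarrow> ?r")
  proof
    assume ?l
    then obtain t n where "t \<in> pda_words M" "s = take n t" by auto
    then show ?r by (metis append_take_drop_id)
  next
    assume ?r
    then obtain t where "s @ t \<in> pda_words M" by blast
    then show ?l by (auto intro!: bexI[of _ "s @ t"] image_eqI[of _ _ "length s"])
  qed
  then show ?thesis unfolding pda_nonterms_def by (auto simp: image_iff)
qed

lemma pda_prods_nonterms:
  assumes M: "pda M" and "(A, B, C) \<in> pda_prods M" "A \<in> pda_nonterms M"
  shows "B \<in> pda_nonterms M \<and> C \<in> pda_nonterms M"
proof -
  have L: "Letter a \<in> pda_nonterms M" if "a \<in> insert None (Some ` pda_input M)" for a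
    using that unfolding pda_nonterms_def by blast
  have Pop: "Pop p z q \<in> pda_nonterms M \<longleftrightarrow>
    p \<in> pda_states M \<and> z \<in> pda_stack M \<and> q \<in> pda_states M" for p z q
    unfolding pda_nonterms_def by (auto simp: image_iff)
  have tr: "r \<in> pda_states M \<and> t @ [] \<in> pda_words M"
    if "(r, t) \<in> pda_trans M p a z" "p \<in> pda_states M" "a \<in> insert None (Some ` pda_input M)"
      "z \<in> insert None (Some ` pda_stack M)" for r t p a z
  proof
    show "r \<in> pda_states M" using that M unfolding pda_def by blast
    have "t \<in> snd ` pda_trans M p a z" using that(1) by (rule image_eqI[rotated]) simp
    then show "t @ [] \<in> pda_words M" unfolding pda_words_def append_Nil2 using that(2-4) by blast
  qed
  from assms(2) show ?thesis
  proof cases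
    case (1 r t p a q)
    have "p \<in> pda_states M" "q \<in> pda_states M"
      using assms(3) unfolding 1(1) Pops_pda_nonterms by auto
    then show ?thesis using 1(4,5) L tr[of r t p a None] unfolding 1(2,3) Pops_pda_nonterms by blast
  next
    case (2 r t p a z q)
    have "p \<in> pda_states M" "z \<in> pda_stack M" "q \<in> pda_states M"
      using assms(3) unfolding 2(1) Pop by auto
    then show ?thesis
      using 2(4,5) L tr[of r t p a "Some z"] unfolding 2(2,3) Pops_pda_nonterms by blast
  next
    case (3 r b p s z q)
    obtain t where t: "(s @ [z]) @ t \<in> pda_words M" "p \<in> pda_states M" "q \<in> pda_states M"
      using assms(3) unfolding 3(1) Pops_pda_nonterms by blast
    then have "z \<in> pda_stack M" using pda_words_lists[OF M t(1)] by auto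
    then show ?thesis using 3(4) t unfolding 3(2,3) Pops_pda_nonterms Pop append_assoc by blast
  qed
qed

text \<open>\<open>runs\<close> speaks only of moves, but \<open>pda_language\<close> also demands
  that the word is over the input alphabet; this supplies that half of soundness.\<close>

lemma pda_gen_lists:
  assumes M: "pda M" and "pda_gen M A w" "A \<in> pda_nonterms M"
  shows "w \<in> lists (pda_input M)"
  using assms(2,3)
proof (induction rule: gen.induct)
  case (gen_unit A w)
  then show ?case by (cases rule: pda_units.cases) (auto simp: pda_nonterms_def)
next
  case (gen_bin A B C u v)
  then show ?case using pda_prods_nonterms[OF M gen_bin(1)] by auto
qed

text \<open>The accepting state is part of the start nonterminal \<open>S\<close>, which therefore
  varies with the word. All choices lie in \<open>pda_nonterms M\<close>, so one family
  \<open>F\<close> serves every word.\<close>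

lemma context_free_language_splits:
  fixes L :: "'a list set"
  assumes "context_free_language \<Sigma> L"
  shows "\<exists>F. finite F \<and> (\<forall>\<alpha> u \<beta>. \<alpha> @ u @ \<beta> \<in> L \<longrightarrow> splits F L \<alpha> u \<beta>)"
proof -
  from assms obtain M :: "(nat, 'a, nat) pda" where
    M: "pda M" "pda_input M = \<Sigma>" "pda_language M = L"
    unfolding context_free_language_def by blast
  define F where "F = (\<lambda>A. Collect (pda_gen M A)) ` pda_nonterms M"
  have "splits F L \<alpha> u \<beta>" if w: "\<alpha> @ u @ \<beta> \<in> L" for \<alpha> u \<beta>
  proof -
    obtain q where q: "q \<in> pda_finals M" "\<alpha> @ u @ \<beta> \<in> lists (pda_input M)"
      "(pda_step M)\<^sup>*\<^sup>* (pda_init M, \<alpha> @ u @ \<beta>, [pda_start M]) (q, [], [])"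
      using w M(3) unfolding pda_language_def by blast
    define S :: "(nat, 'a, nat) nonterm" where "S = Pops True (pda_init M) [pda_start M] q"
    have "pda_gen M S (\<alpha> @ u @ \<beta>)"
      unfolding S_def by (intro pda_gen_complete q M(1)) (use M(1) in \<open>simp_all add: pda_def\<close>)
    moreover have "[pda_start M] @ [] \<in> pda_words M" by (simp add: pda_words_def)
    then have S: "S \<in> pda_nonterms M"
      unfolding S_def Pops_pda_nonterms using M(1) q(1) unfolding pda_def by blast
    ultimately have "splits F (Collect (pda_gen M S)) \<alpha> u \<beta>"
      unfolding F_def
    proof (intro gen_splits)
      show "B \<in> pda_nonterms M \<and> C \<in> pda_nonterms M"
        if "(A, B, C) \<in> pda_prods M" "A \<in> pda_nonterms M" for A B C
        using pda_prods_nonterms[OF M(1) that] .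
    qed (auto elim: pda_units.cases)
    \<comment> \<open>With empty context this merely replaces the language of \<open>S\<close> by
      the larger language \<open>L\<close>.\<close>
    then have "splits F L ([] @ \<alpha>) u (\<beta> @ [])"
    proof (rule splits_context)
      fix v assume "v \<in> Collect (pda_gen M S)"
      then have v: "pda_gen M S v" by simp
      then have "(pda_step M)\<^sup>*\<^sup>* (pda_init M, v @ [], [] @ [pda_start M]) (q, [], [])"
        using pda_gen_sound[OF v] unfolding S_def by (simp del: append_Nil append_Nil2)
      then show "[] @ v @ [] \<in> L"
        using q(1) pda_gen_lists[OF M(1) v S] M(3) unfolding pda_language_def by auto
    qed
    then show ?thesis by simp
  qed
  then show ?thesis using finite_pda_nonterms[OF M(1)] F_def by blast
qed

section \<open>Words acting on the vertices\<close>

declare in_lists_conv_set [simp del] in_listsD [rule del] in_listsI [rule del]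

locale word_action =
  fixes X :: "('v, 'a) lgraph" and i :: "'a \<Rightarrow> 'a" and r :: 'v
  assumes graph: "labelled_graph X"
    and det: "lg_fully_deterministic X"
    and connected: "lg_connected X"
    and i_closed: "a \<in> lg_alphabet X \<Longrightarrow> i a \<in> lg_alphabet X"
    and i_i: "a \<in> lg_alphabet X \<Longrightarrow> i (i a) = a"
    and edge_sym: "(x, a, y) \<in> lg_edges X \<Longrightarrow> (y, i a, x) \<in> lg_edges X"
    and root: "r \<in> lg_verts X"
begin

abbreviation "\<Sigma> \<equiv> lg_alphabet X"
abbreviation "V \<equiv> lg_verts X"

definition nxt :: "'v \<Rightarrow> 'a \<Rightarrow> 'v" where
  "nxt x a = (THE y. (x, a, y) \<in> lg_edges X)"

abbreviation act :: "'v \<Rightarrow> 'a list \<Rightarrow> 'v" where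
  "act \<equiv> foldl nxt"

definition winv :: "'a list \<Rightarrow> 'a list" where
  "winv w = rev (map i w)"

lemma finite_alphabet: "finite \<Sigma>"
  using graph unfolding labelled_graph_def by blast

lemma edge_iff: "(x, a, y) \<in> lg_edges X \<longleftrightarrow> x \<in> V \<and> a \<in> \<Sigma> \<and> y = nxt x a"
proof -
  have ex1: "\<exists>!y. (x, a, y) \<in> lg_edges X" if "x \<in> V" "a \<in> \<Sigma>"
  proof -
    from det that have "\<exists>!e. e \<in> lg_edges X \<and> fst e = x \<and> lg_label e = a"
      unfolding lg_fully_deterministic_def by blast
    then show ?thesis by (auto simp: Ex1_def)
  qed
  have "x \<in> V \<and> a \<in> \<Sigma>" if "(x, a, y) \<in> lg_edges X"
    using that graph unfolding labelled_graph_def by auto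
  then show ?thesis
    using ex1 the1_equality[OF ex1] theI'[OF ex1] unfolding nxt_def by blast
qed

lemma nxt_verts [simp]: "x \<in> V \<Longrightarrow> a \<in> \<Sigma> \<Longrightarrow> nxt x a \<in> V"
  using edge_iff edge_sym by blast

lemma nxt_nxt_i [simp]: "x \<in> V \<Longrightarrow> a \<in> \<Sigma> \<Longrightarrow> nxt (nxt x a) (i a) = x"
  using edge_iff edge_sym by metis

lemma act_verts [simp]: "x \<in> V \<Longrightarrow> w \<in> lists \<Sigma> \<Longrightarrow> act x w \<in> V"
  by (induction w arbitrary: x) auto

lemma winv_lists [simp]: "w \<in> lists \<Sigma> \<Longrightarrow> winv w \<in> lists \<Sigma>"
  unfolding winv_def using i_closed by (auto simp: in_lists_conv_set)

lemma length_winv [simp]: "length (winv w) = length w"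
  unfolding winv_def by simp

lemma winv_simps [simp]: "winv [] = []" "winv (a # w) = winv w @ [i a]" "winv (u @ v) = winv v @ winv u"
  unfolding winv_def by simp_all

lemma winv_winv [simp]: "w \<in> lists \<Sigma> \<Longrightarrow> winv (winv w) = w"
  unfolding winv_def using i_i by (auto simp: in_lists_conv_set rev_map intro!: map_idI)

lemma act_winv [simp]: "x \<in> V \<Longrightarrow> w \<in> lists \<Sigma> \<Longrightarrow> act (act x w) (winv w) = x"
  by (induction w arbitrary: x) (auto simp: winv_def)

lemma act_winv' [simp]: "x \<in> V \<Longrightarrow> w \<in> lists \<Sigma> \<Longrightarrow> act (act x (winv w)) w = x"
  using act_winv[of x "winv w"] by simp

lemma act_eq_iff:
  "x \<in> V \<Longrightarrow> y \<in> V \<Longrightarrow> w \<in> lists \<Sigma> \<Longrightarrow> act x w = y \<longleftrightarrow> x = act y (winv w)"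
  by auto

text \<open>Words act as permutations of the vertices. This cancellation turns the statement that
  all words of a language fit one context into the statement that they join the same two
  vertices.\<close>

lemma act_inj: "x \<in> V \<Longrightarrow> y \<in> V \<Longrightarrow> w \<in> lists \<Sigma> \<Longrightarrow> act x w = act y w \<Longrightarrow> x = y"
  by (metis act_winv)

section \<open>Paths inside a set of vertices, described by their labels\<close>

primrec stays :: "'v set \<Rightarrow> 'v \<Rightarrow> 'a list \<Rightarrow> bool" where
  "stays C x [] \<longleftrightarrow> x \<in> C"
| "stays C x (a # w) \<longleftrightarrow> x \<in> C \<and> a \<in> \<Sigma> \<and> stays C (nxt x a) w"

lemma stays_lists: "stays C x w \<Longrightarrow> w \<in> lists \<Sigma>"
  by (induction w arbitrary: x) auto

lemma stays_start: "stays C x w \<Longrightarrow> x \<in> C"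
  by (cases w) auto

lemma stays_end: "stays C x w \<Longrightarrow> act x w \<in> C"
  by (induction w arbitrary: x) auto

lemma stays_append [simp]: "stays C x (u @ v) \<longleftrightarrow> stays C x u \<and> stays C (act x u) v"
  by (induction u arbitrary: x) (auto dest: stays_start)

lemma stays_mono: "stays C x w \<Longrightarrow> C \<subseteq> D \<Longrightarrow> stays D x w"
  by (induction w arbitrary: x) auto

lemma stays_verts: "x \<in> V \<Longrightarrow> stays V x w \<longleftrightarrow> w \<in> lists \<Sigma>"
  by (induction w arbitrary: x) auto

lemma stays_winv: "stays C x w \<Longrightarrow> C \<subseteq> V \<Longrightarrow> stays C (act x w) (winv w)"
proof (induction w arbitrary: x)
  case (Cons a w)
  then have "x \<in> V" by auto
  moreover have "stays C (nxt x a) w" using Cons by simp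
  ultimately show ?case
    using Cons stays_start[of C "nxt x a" w] stays_lists[of C "nxt x a" w] i_closed
    by (auto dest: stays_end)
qed simp

lemma stays_exit:
  assumes "x \<in> C" "w \<in> lists \<Sigma>" "act x w \<notin> C"
  shows "\<exists>y a. y \<in> C \<and> a \<in> \<Sigma> \<and> nxt y a \<notin> C"
  using assms by (induction w arbitrary: x) auto

text \<open>By determinism a path is given by its start and its label, so graph paths can be
  replaced by words from here on.\<close>

lemma path_induced_iff:
  assumes "C \<subseteq> V"
  shows "(\<exists>es. lg_path (lg_induced X C) x es y \<and> map lg_label es = w) \<longleftrightarrow>
    stays C x w \<and> act x w = y"
proof
  have "stays C x (map lg_label es) \<and> act x (map lg_label es) = y"
    if "lg_path (lg_induced X C) x es y" for es
    using that by (induction rule: lg_path.induct) (auto simp: lg_induced_def edge_iff)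
  then show "\<exists>es. lg_path (lg_induced X C) x es y \<and> map lg_label es = w \<Longrightarrow>
    stays C x w \<and> act x w = y" by blast
next
  show "stays C x w \<and> act x w = y \<Longrightarrow>
    \<exists>es. lg_path (lg_induced X C) x es y \<and> map lg_label es = w"
  proof (induction w arbitrary: x)
    case Nil
    then show ?case by (auto simp: lg_induced_def intro!: lg_path.Nil)
  next
    case (Cons a w)
    then obtain es where es: "lg_path (lg_induced X C) (nxt x a) es y" "map lg_label es = w"
      by auto
    have "(x, a, nxt x a) \<in> lg_edges (lg_induced X C)"
      using Cons assms stays_start[of C "nxt x a" w] by (auto simp: lg_induced_def edge_iff)
    then have "lg_path (lg_induced X C) x ((x, a, nxt x a) # es) y"
      using es by (intro lg_path.Cons)
    then show ?case using es by fastforce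
  qed
qed

lemma induced_verts: "lg_induced X V = X"
proof -
  have "{(x, a, y) \<in> lg_edges X. x \<in> V \<and> y \<in> V} = lg_edges X"
    by (auto simp: edge_iff)
  then show ?thesis unfolding lg_induced_def by simp
qed

lemma path_iff:
  "x \<in> V \<Longrightarrow> (\<exists>es. lg_path X x es y \<and> map lg_label es = w) \<longleftrightarrow> w \<in> lists \<Sigma> \<and> act x w = y"
  using path_induced_iff[of V x y w] induced_verts stays_verts by auto

lemma language_eq:
  assumes "x \<in> V"
  shows "lg_language X x y = {w \<in> lists \<Sigma>. act x w = y}"
proof -
  have "lg_language X x y = {w. \<exists>es. lg_path X x es y \<and> map lg_label es = w}"
    unfolding lg_language_def by blast
  then show ?thesis using path_iff[OF assms] by simp
qed

lemma reach:
  assumes "x \<in> V" "y \<in> V"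
  obtains w where "w \<in> lists \<Sigma>" "act x w = y"
  using connected assms path_iff[of x y] unfolding lg_connected_def lg_joined_def by blast

section \<open>Distance from the root\<close>

text \<open>Measured towards the root, to agree with \<open>lg_ball\<close>; \<open>winv\<close>
  turns a shortest word to the root into a word of the same length from it.\<close>

definition depth :: "'v \<Rightarrow> nat" where
  "depth x = lg_dist X x r"

lemma depth_le: "x \<in> V \<Longrightarrow> w \<in> lists \<Sigma> \<Longrightarrow> act x w = r \<Longrightarrow> depth x \<le> length w"
  unfolding depth_def lg_dist_def using path_iff[of x r w]
  by (intro Least_le) (metis length_map)

lemma depth_word:
  assumes "x \<in> V"
  obtains w where "w \<in> lists \<Sigma>" "act x w = r" "length w = depth x"
proof -
  obtain w where "w \<in> lists \<Sigma>" "act x w = r" using reach assms root by blast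
  then have "\<exists>n es. lg_path X x es r \<and> length es = n" using path_iff[OF assms] by blast
  from LeastI_ex[OF this] obtain es where "lg_path X x es r" "length es = depth x"
    unfolding depth_def lg_dist_def by blast
  moreover from this have "map lg_label es \<in> lists \<Sigma> \<and> act x (map lg_label es) = r"
    using path_iff[OF assms, of r "map lg_label es"] by blast
  ultimately show ?thesis using that[of "map lg_label es"] by simp
qed

lemma depth_act_le:
  assumes "x \<in> V" "w \<in> lists \<Sigma>"
  shows "depth x \<le> length w + depth (act x w)"
proof -
  obtain u where "u \<in> lists \<Sigma>" "act (act x w) u = r" "length u = depth (act x w)"
    using depth_word assms by (metis act_verts)
  then show ?thesis using depth_le[of x "w @ u"] assms by auto
qed

lemma depth_act_root: "w \<in> lists \<Sigma> \<Longrightarrow> depth (act r w) \<le> length w"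
  using depth_le[of "act r w" "winv w"] root by simp

lemma depth_0_iff: "x \<in> V \<Longrightarrow> depth x = 0 \<longleftrightarrow> x = r"
  using depth_le[of r "[]"] root by (auto elim!: depth_word[of x])

text \<open>The first letter of a shortest word to the root does this.\<close>

lemma nxt_closer:
  assumes "x \<in> V" "depth x = Suc n"
  obtains a where "a \<in> \<Sigma>" "depth (nxt x a) = n"
proof -
  obtain w where w: "w \<in> lists \<Sigma>" "act x w = r" "length w = Suc n"
    using depth_word assms by metis
  then obtain a u where "w = a # u" by (cases w) auto
  then have "a \<in> \<Sigma>" "depth (nxt x a) \<le> n" "Suc n \<le> 1 + depth (nxt x a)"
    using w depth_le[of "nxt x a" u] depth_act_le[of x "[a]"] assms by auto
  then show ?thesis using that by simp
qed

lemma finite_ball: "finite {x \<in> V. depth x \<le> n}"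
proof (rule finite_subset)
  show "{x \<in> V. depth x \<le> n} \<subseteq> act r ` {w. set w \<subseteq> \<Sigma> \<and> length w \<le> n}"
  proof
    fix x assume x: "x \<in> {x \<in> V. depth x \<le> n}"
    then obtain w where "w \<in> lists \<Sigma>" "act x w = r" "length w = depth x"
      using depth_word by blast
    then show "x \<in> act r ` {w. set w \<subseteq> \<Sigma> \<and> length w \<le> n}"
      using x winv_lists[of w] by (intro image_eqI[of _ _ "winv w"]) (auto simp: in_lists_conv_set)
  qed
  show "finite (act r ` {w. set w \<subseteq> \<Sigma> \<and> length w \<le> n})"
    using finite_lists_length_le finite_alphabet by blast
qed

section \<open>Components and cones\<close>

text \<open>A local description of the components of the graph induced on \<open>U\<close>, by
  connectedness inside \<open>C\<close> and closure under steps within \<open>U\<close>;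
  \<open>components_iff\<close> matches it with the quotient.\<close>

definition component :: "'v set \<Rightarrow> 'v set \<Rightarrow> bool" where
  "component U C \<longleftrightarrow> C \<noteq> {} \<and> C \<subseteq> U \<and> (\<forall>x\<in>C. \<forall>y\<in>C. \<exists>w. stays C x w \<and> act x w = y) \<and>
     (\<forall>x\<in>C. \<forall>a\<in>\<Sigma>. nxt x a \<in> U \<longrightarrow> nxt x a \<in> C)"

lemma component_path:
  assumes "component U C" "x \<in> C" "y \<in> C"
  obtains w where "stays C x w" "act x w = y"
  using assms unfolding component_def by blast

definition part :: "'v set \<Rightarrow> 'v \<Rightarrow> 'v set" where
  "part U x = {act x w | w. stays U x w}"

lemma stays_part:
  assumes "stays U x w"
  shows "stays (part U x) x w"
  using assms
proof (induction w rule: rev_induct)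
  case (snoc a w)
  then have "act x (w @ [a]) \<in> part U x" unfolding part_def by blast
  then show ?case using snoc by (auto dest: stays_end)
qed (auto simp: part_def intro!: exI[of _ "[]"])

lemma component_part:
  assumes "U \<subseteq> V" "x \<in> U"
  shows "component U (part U x)"
  unfolding component_def
proof (intro conjI ballI impI)
  show "part U x \<subseteq> U" unfolding part_def using stays_end by blast
  show "part U x \<noteq> {}" unfolding part_def using assms(2) stays.simps(1) by blast
next
  fix y z assume "y \<in> part U x" "z \<in> part U x"
  then obtain u v where u: "stays U x u" "y = act x u" and v: "stays U x v" "z = act x v"
    unfolding part_def by blast
  have "part U x \<subseteq> V" unfolding part_def using stays_end assms by blast
  then have "stays (part U x) y (winv u)" using stays_winv stays_part u by blast
  moreover have "act y (winv u) = x" using u assms stays_lists by auto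
  ultimately have "stays (part U x) y (winv u @ v)" "act y (winv u @ v) = z"
    using v stays_part by auto
  then show "\<exists>w. stays (part U x) y w \<and> act y w = z" by blast
next
  fix y a assume "y \<in> part U x" and a: "a \<in> \<Sigma>" "nxt y a \<in> U"
  then obtain u where u: "stays U x u" "y = act x u" unfolding part_def by blast
  then have "stays U x (u @ [a])" using a stays_end by auto
  then show "nxt y a \<in> part U x" unfolding part_def using u by (auto intro!: exI[of _ "u @ [a]"])
qed

lemma component_stays:
  assumes "component U C" "x \<in> C" "stays U x w"
  shows "stays C x w"
  using assms(2,3)
proof (induction w arbitrary: x)
  case (Cons a w)
  moreover have "nxt x a \<in> U" using Cons.prems(2) by (auto dest: stays_start)
  ultimately show ?case using assms(1) unfolding component_def by simp
qed simp

lemma component_eq_part: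
  assumes "component U C" "x \<in> C"
  shows "C = part U x"
proof
  show "C \<subseteq> part U x"
  proof
    fix y assume "y \<in> C"
    then obtain w where "stays C x w" "act x w = y" using component_path[OF assms] by blast
    moreover from this have "stays U x w" using assms(1) stays_mono unfolding component_def by blast
    ultimately show "y \<in> part U x" unfolding part_def by blast
  qed
  show "part U x \<subseteq> C"
    using component_stays[OF assms] stays_end unfolding part_def by blast
qed

text \<open>Inverse words make being joined symmetric, so the class of \<open>x\<close> is
  \<open>part U x\<close>.\<close>

lemma components_iff:
  assumes "U \<subseteq> V"
  shows "C \<in> lg_components (lg_induced X U) \<longleftrightarrow> component U C"
proof -
  let ?R = "{(x, y). x \<in> U \<and> y \<in> U \<and> lg_joined (lg_induced X U) x y \<and>
    lg_joined (lg_induced X U) y x}"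
  have joined: "lg_joined (lg_induced X U) x y \<longleftrightarrow> (\<exists>w. stays U x w \<and> act x w = y)" for x y
    unfolding lg_joined_def using path_induced_iff[OF assms, of x y] by blast
  have sym: "\<exists>w. stays U y w \<and> act y w = x" if "stays U x w" "act x w = y" for x y w
    using stays_winv[OF that(1) assms] that act_winv stays_lists stays_start assms
    by (metis subset_iff)
  have R: "?R `` {x} = part U x" if "x \<in> U" for x
    unfolding joined part_def using that sym by (auto dest: stays_end)
  have verts: "lg_verts (lg_induced X U) = U" by (simp add: lg_induced_def)
  have "C \<in> lg_components (lg_induced X U) \<longleftrightarrow> (\<exists>x\<in>U. C = part U x)"
    unfolding lg_components_def verts quotient_def using R by auto
  also have "\<dots> \<longleftrightarrow> component U C"
    using component_part[OF assms] component_eq_part by (metis component_def ex_in_conv subset_iff)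
  finally show ?thesis .
qed

abbreviation outside :: "nat \<Rightarrow> 'v set" where
  "outside n \<equiv> {x \<in> V. depth x > n}"

lemma cones_iff: "C \<in> lg_cones X r \<longleftrightarrow> (\<exists>n. component (outside n) C)"
proof -
  have "V - lg_ball X r n = outside n" for n
    unfolding lg_ball_def depth_def by auto
  then show ?thesis unfolding lg_cones_def using components_iff[of "outside _"] by auto
qed

section \<open>The boundary of a cone\<close>

abbreviation bdry :: "'v set \<Rightarrow> 'v set" where
  "bdry \<equiv> lg_boundary X"

lemma bdry_iff:
  assumes "C \<subseteq> V"
  shows "x \<in> bdry C \<longleftrightarrow> x \<in> C \<and> (\<exists>a\<in>\<Sigma>. nxt x a \<notin> C)"
proof -
  have "lg_neighbour X x y \<longleftrightarrow> (\<exists>a\<in>\<Sigma>. y = nxt x a)" if "x \<in> V" "y \<in> V" for x y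
    unfolding lg_neighbour_def using edge_iff[of x _ y] edge_sym[of y _ x] that by blast
  then have "(\<exists>y\<in>V - C. lg_neighbour X x y) \<longleftrightarrow> (\<exists>a\<in>\<Sigma>. nxt x a \<notin> C)" if "x \<in> V" for x
    using that nxt_verts by blast
  then show ?thesis unfolding lg_boundary_def using assms by blast
qed

lemma cone_verts: "component (outside n) C \<Longrightarrow> C \<subseteq> V"
  unfolding component_def by auto

text \<open>An edge leaving \<open>C\<close> cannot end in \<open>outside n\<close>, so it ends at
  depth at most \<open>n\<close> and starts at depth \<open>Suc n\<close>. Conversely, from that
  depth some edge leads towards the root, out of the cone.\<close>

lemma bdry_cone:
  assumes "component (outside n) C"
  shows "bdry C = {x \<in> C. depth x = Suc n}"
proof (intro equalityI subsetI)
  fix x assume x: "x \<in> bdry C"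
  then obtain a where a: "x \<in> C" "a \<in> \<Sigma>" "nxt x a \<notin> C"
    using bdry_iff[OF cone_verts[OF assms]] by blast
  then have "x \<in> V" "depth x > n" "nxt x a \<notin> outside n"
    using assms unfolding component_def by auto
  then have "depth x = Suc n" using depth_act_le[of x "[a]"] a by auto
  then show "x \<in> {x \<in> C. depth x = Suc n}" using a by simp
next
  fix x assume x: "x \<in> {x \<in> C. depth x = Suc n}"
  then have "x \<in> V" using cone_verts[OF assms] by auto
  then obtain a where a: "a \<in> \<Sigma>" "depth (nxt x a) = n" using nxt_closer x by blast
  then have "nxt x a \<notin> C" using assms unfolding component_def by auto
  then show "x \<in> bdry C" using bdry_iff[OF cone_verts[OF assms]] a x by blast
qed

text \<open>A path from a vertex of the cone to the root has to leave the cone.\<close>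

lemma bdry_cone_nonempty:
  assumes "component (outside n) C"
  shows "bdry C \<noteq> {}"
proof -
  obtain x where x: "x \<in> C" using assms unfolding component_def by blast
  then have "x \<in> V" using cone_verts assms by blast
  then obtain w where "w \<in> lists \<Sigma>" "act x w = r" using reach root by blast
  moreover have "depth r = 0" using depth_0_iff root by simp
  then have "r \<notin> C" using assms unfolding component_def by auto
  ultimately obtain y a where "y \<in> C" "a \<in> \<Sigma>" "nxt y a \<notin> C" using stays_exit x by blast
  then show ?thesis using bdry_iff[OF cone_verts[OF assms]] by blast
qed

lemma finite_bdry_cone: "component (outside n) C \<Longrightarrow> finite (bdry C)"
  using cone_verts[of n C] by (intro finite_subset[OF _ finite_ball[of "Suc n"]]) (auto simp: bdry_cone)

text \<open>The condition on boundaries is absorbed: if \<open>f\<close> respects which letters lead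
  out of the cone, it matches the boundaries.\<close>

lemma cone_iso_iff:
  assumes "C \<subseteq> V" "C' \<subseteq> V"
  shows "lg_cone_iso X C C' \<longleftrightarrow> (\<exists>f. bij_betw f C C' \<and>
    (\<forall>x\<in>C. \<forall>a\<in>\<Sigma>. (nxt x a \<in> C \<longleftrightarrow> nxt (f x) a \<in> C') \<and> (nxt x a \<in> C \<longrightarrow> f (nxt x a) = nxt (f x) a)))"
  (is "?l \<longleftrightarrow> ?r")
proof
  assume ?l
  then obtain f where f: "bij_betw f C C'"
    "\<And>x y a. x \<in> C \<Longrightarrow> y \<in> C \<Longrightarrow> (x, a, y) \<in> lg_edges X \<longleftrightarrow> (f x, a, f y) \<in> lg_edges X"
    unfolding lg_cone_iso_def by blast
  have "(nxt x a \<in> C \<longleftrightarrow> nxt (f x) a \<in> C') \<and> (nxt x a \<in> C \<longrightarrow> f (nxt x a) = nxt (f x) a)"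
    if "x \<in> C" "a \<in> \<Sigma>" for x a
  proof -
    have *: "f x \<in> C'" using f(1) that bij_betwE by blast
    have 1: "f (nxt x a) = nxt (f x) a" "nxt (f x) a \<in> C'" if "nxt x a \<in> C"
      using f(2)[OF \<open>x \<in> C\<close> that, of a] edge_iff that assms \<open>x \<in> C\<close> \<open>a \<in> \<Sigma>\<close> bij_betwE[OF f(1)] by auto
    \<comment> \<open>Edges are compared only between vertices of \<open>C\<close>, so surjectivity
      must first provide a preimage of the target.\<close>
    have "nxt x a \<in> C" if c: "nxt (f x) a \<in> C'"
    proof -
      obtain y where y: "y \<in> C" "f y = nxt (f x) a"
        using c f(1) by (metis bij_betw_def imageE)
      then have "(x, a, y) \<in> lg_edges X"
        using f(2)[OF \<open>x \<in> C\<close> y(1), of a] edge_iff * \<open>a \<in> \<Sigma>\<close> assms by auto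
      then show ?thesis using y edge_iff by auto
    qed
    with 1 show ?thesis by blast
  qed
  with f(1) show ?r by blast
next
  assume ?r
  then obtain f where f: "bij_betw f C C'"
    and n: "\<And>x a. x \<in> C \<Longrightarrow> a \<in> \<Sigma> \<Longrightarrow> nxt x a \<in> C \<longleftrightarrow> nxt (f x) a \<in> C'"
      "\<And>x a. x \<in> C \<Longrightarrow> a \<in> \<Sigma> \<Longrightarrow> nxt x a \<in> C \<Longrightarrow> f (nxt x a) = nxt (f x) a"
    by blast
  have e: "(x, a, y) \<in> lg_edges X \<longleftrightarrow> (f x, a, f y) \<in> lg_edges X" if "x \<in> C" "y \<in> C" for x a y
  proof
    assume "(x, a, y) \<in> lg_edges X"
    then show "(f x, a, f y) \<in> lg_edges X"
      using n(2)[of x a] that edge_iff bij_betwE[OF f] assms by auto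
  next
    assume "(f x, a, f y) \<in> lg_edges X"
    then have "a \<in> \<Sigma>" "f y = nxt (f x) a" using edge_iff by auto
    then show "(x, a, y) \<in> lg_edges X"
      using n[of x a] that edge_iff bij_betwE[OF f] assms bij_betw_imp_inj_on[OF f]
      by (metis inj_onD subset_iff)
  qed
  have "f ` bdry C = bdry C'"
  proof
    show "f ` bdry C \<subseteq> bdry C'"
      unfolding bdry_iff[OF assms(1)] bdry_iff[OF assms(2)] image_subset_iff Ball_def
      using n(1) bij_betwE[OF f] by (metis bdry_iff assms)
    show "bdry C' \<subseteq> f ` bdry C"
    proof
      fix y assume y: "y \<in> bdry C'"
      then obtain x where "x \<in> C" "y = f x" using f by (auto simp: bdry_iff assms bij_betw_def)
      then show "y \<in> f ` bdry C" using y n(1) by (auto simp: bdry_iff assms)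
    qed
  qed
  with f e show ?l unfolding lg_cone_iso_def by blast
qed

text \<open>The isomorphism sends \<open>act x u\<close> to \<open>act x' u\<close>. By
  \<open>eq\<close> it is well defined and injective; by \<open>st\<close> it is onto and respects
  which letters lead out.\<close>

lemma cone_iso_by_words:
  assumes C: "component U C" "x \<in> C" "C \<subseteq> V" and C': "component U' C'" "x' \<in> C'" "C' \<subseteq> V"
    and st: "\<And>u. stays C x u \<longleftrightarrow> stays C' x' u"
    and eq: "\<And>u v. stays C x u \<Longrightarrow> stays C x v \<Longrightarrow> act x u = act x v \<longleftrightarrow> act x' u = act x' v"
  shows "lg_cone_iso X C C'"
proof -
  define f where "f y = act x' (SOME u. stays C x u \<and> act x u = y)" for y
  have f: "f (act x u) = act x' u" if "stays C x u" for u
  proof -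
    have "stays C x (SOME v. stays C x v \<and> act x v = act x u) \<and>
        act x (SOME v. stays C x v \<and> act x v = act x u) = act x u"
      using that by (intro someI_ex[of "\<lambda>v. stays C x v \<and> act x v = act x u"]) blast
    then show ?thesis unfolding f_def using eq that by blast
  qed
  have word: "\<exists>u. stays C x u \<and> y = act x u" if "y \<in> C" for y
    by (rule component_path[OF C(1,2) that]) auto
  have word': "\<exists>u. stays C x u \<and> y = act x' u" if "y \<in> C'" for y
    by (rule component_path[OF C'(1,2) that]) (auto simp: st)
  have "inj_on f C"
  proof (rule inj_onI)
    fix y z assume "y \<in> C" "z \<in> C" and e: "f y = f z"
    then obtain u v where u: "stays C x u" "y = act x u" and v: "stays C x v" "z = act x v"
      using word by metis
    then show "y = z" using e eq[OF u(1) v(1)] f by simp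
  qed
  moreover have "f ` C = C'"
  proof
    show "f ` C \<subseteq> C'"
      using f st by (auto dest!: word) (auto dest: stays_end)
    show "C' \<subseteq> f ` C"
    proof
      fix y assume "y \<in> C'"
      then obtain u where "stays C x u" "y = act x' u" using word' by blast
      then show "y \<in> f ` C" using f by (intro image_eqI[of _ _ "act x u"]) (auto dest: stays_end)
    qed
  qed
  moreover have "(nxt y a \<in> C \<longleftrightarrow> nxt (f y) a \<in> C') \<and> (nxt y a \<in> C \<longrightarrow> f (nxt y a) = nxt (f y) a)"
    if "y \<in> C" "a \<in> \<Sigma>" for y a
  proof -
    obtain u where u: "stays C x u" "y = act x u" using word[OF \<open>y \<in> C\<close>] by blast
    have 1: "nxt y a \<in> C \<longleftrightarrow> stays C x (u @ [a])" using u stays_end that by auto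
    have 2: "nxt (f y) a \<in> C' \<longleftrightarrow> stays C' x' (u @ [a])"
      using u f st[of u] that by (auto dest: stays_end)
    have "f (nxt y a) = nxt (f y) a" if "nxt y a \<in> C"
      using that f[of "u @ [a]"] f[OF u(1)] u(2) unfolding 1 by simp
    then show ?thesis using 1 2 st by blast
  qed
  ultimately show ?thesis unfolding cone_iso_iff[OF C(3) C'(3)] bij_betw_def by blast
qed

end

section \<open>Finitely many cone types\<close>

text \<open>One element chosen for each value of \<open>h\<close> meets every class;
  \<open>h\<close> may take several values on one class.\<close>

lemma finite_quotient_invariant:
  assumes R: "equiv A R" and "finite (h ` A)"
    and h: "\<And>x y. x \<in> A \<Longrightarrow> y \<in> A \<Longrightarrow> h x = h y \<Longrightarrow> (x, y) \<in> R"
  shows "finite (A // R)"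
proof (rule finite_subset)
  show "finite ((\<lambda>d. R `` {SOME x. x \<in> A \<and> h x = d}) ` h ` A)" using assms(2) by blast
  show "A // R \<subseteq> (\<lambda>d. R `` {SOME x. x \<in> A \<and> h x = d}) ` h ` A"
  proof
    fix Y assume "Y \<in> A // R"
    then obtain x where x: "x \<in> A" "Y = R `` {x}" by (rule quotientE)
    define y where "y = (SOME y. y \<in> A \<and> h y = h x)"
    have "y \<in> A \<and> h y = h x"
      unfolding y_def by (rule someI[of _ x]) (simp add: x)
    then have "Y = R `` {y}" using equiv_class_eq[OF R h] x by metis
    then show "Y \<in> (\<lambda>d. R `` {SOME x. x \<in> A \<and> h x = d}) ` h ` A"
      unfolding y_def using x(1) by blast
  qed
qed

lemma equiv_lg_cone_iso: "equiv S {(C, C'). C \<in> S \<and> C' \<in> S \<and> lg_cone_iso G C C'}"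
proof (rule equivI)
  show "{(C, C'). C \<in> S \<and> C' \<in> S \<and> lg_cone_iso G C C'} \<subseteq> S \<times> S" by blast
  show "refl_on S {(C, C'). C \<in> S \<and> C' \<in> S \<and> lg_cone_iso G C C'}"
    by (rule refl_onI) (auto simp: lg_cone_iso_def intro!: exI[of _ id])
  have "lg_cone_iso G C' C" if "lg_cone_iso G C C'" for C C'
  proof -
    from that obtain f where f: "bij_betw f C C'"
      "\<And>x y a. x \<in> C \<Longrightarrow> y \<in> C \<Longrightarrow> (x, a, y) \<in> lg_edges G \<longleftrightarrow> (f x, a, f y) \<in> lg_edges G"
      "f ` lg_boundary G C = lg_boundary G C'"
      unfolding lg_cone_iso_def by blast
    let ?g = "inv_into C f"
    have "bij_betw ?g C' C" using f(1) by (rule bij_betw_inv_into)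
    moreover have "(x, a, y) \<in> lg_edges G \<longleftrightarrow> (?g x, a, ?g y) \<in> lg_edges G"
      if "x \<in> C'" "y \<in> C'" for x y a
      using f(2)[of "?g x" "?g y" a] that f(1)
      by (simp add: bij_betw_inv_into_right bij_betwE[OF calculation])
    moreover have "?g ` lg_boundary G C' = lg_boundary G C"
      unfolding f(3)[symmetric]
      by (rule inv_into_image_cancel) (use f(1) in \<open>auto simp: bij_betw_def lg_boundary_def\<close>)
    ultimately show ?thesis unfolding lg_cone_iso_def by blast
  qed
  then show "sym {(C, C'). C \<in> S \<and> C' \<in> S \<and> lg_cone_iso G C C'}"
    by (auto intro!: symI)
  have "lg_cone_iso G C C''" if "lg_cone_iso G C C'" "lg_cone_iso G C' C''" for C C' C''
  proof -
    from that(1) obtain f where f: "bij_betw f C C'"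
      "\<And>x y a. x \<in> C \<Longrightarrow> y \<in> C \<Longrightarrow> (x, a, y) \<in> lg_edges G \<longleftrightarrow> (f x, a, f y) \<in> lg_edges G"
      "f ` lg_boundary G C = lg_boundary G C'"
      unfolding lg_cone_iso_def by blast
    from that(2) obtain g where g: "bij_betw g C' C''"
      "\<And>x y a. x \<in> C' \<Longrightarrow> y \<in> C' \<Longrightarrow> (x, a, y) \<in> lg_edges G \<longleftrightarrow> (g x, a, g y) \<in> lg_edges G"
      "g ` lg_boundary G C' = lg_boundary G C''"
      unfolding lg_cone_iso_def by blast
    have "bij_betw (g \<circ> f) C C''" using f(1) g(1) by (rule bij_betw_trans)
    moreover have "(x, a, y) \<in> lg_edges G \<longleftrightarrow> ((g \<circ> f) x, a, (g \<circ> f) y) \<in> lg_edges G"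
      if "x \<in> C" "y \<in> C" for x y a
      using f(2) g(2) that bij_betwE[OF f(1)] by simp
    moreover have "(g \<circ> f) ` lg_boundary G C = lg_boundary G C''"
      using f(3) g(3) by (simp flip: image_image[of g f] add: comp_def)
    ultimately show ?thesis unfolding lg_cone_iso_def by blast
  qed
  then show "trans {(C, C'). C \<in> S \<and> C' \<in> S \<and> lg_cone_iso G C C'}"
    by (auto intro!: transI)
qed

text \<open>\<open>K\<close> bounds the length of a shortest word in each nonempty member of
  \<open>F\<close>. The bound \<open>1 \<le> K\<close> covers the terminal case of
  \<open>splits\<close>.\<close>

locale split_language = word_action X i r
  for X :: "('v, 'a) lgraph" and i :: "'a \<Rightarrow> 'a" and r :: 'v +
  fixes F :: "'a list set set" and K :: nat
  assumes finite_F: "finite F"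
    and K: "T \<in> F \<Longrightarrow> v \<in> T \<Longrightarrow> \<exists>v\<in>T. length v \<le> K" "1 \<le> K"
    and splits: "\<alpha> @ u @ \<beta> \<in> lg_language X r r \<Longrightarrow> splits F (lg_language X r r) \<alpha> u \<beta>"
begin

lemma root_language_iff: "w \<in> lg_language X r r \<longleftrightarrow> w \<in> lists \<Sigma> \<and> act r w = r"
  using language_eq[OF root] by simp

definition joins :: "'a list set \<Rightarrow> 'v \<Rightarrow> 'v \<Rightarrow> bool" where
  "joins T p q \<longleftrightarrow> (\<forall>v\<in>T. v \<in> lists \<Sigma> \<and> act p v = q)"

text \<open>However long \<open>u\<close> is, its ends are close to the ends of a word of some
  \<open>T\<close>: the splitting vertex lies in the cone, hence at depth at least
  \<open>Suc n\<close>, and short words of \<open>B\<close> and \<open>D\<close> would bring it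
  nearer to the root if \<open>s\<close> or \<open>t\<close> were long.\<close>

lemma cone_word_cover:
  assumes C: "component (outside n) C" and x: "x \<in> bdry C" and y: "y \<in> bdry C"
    and u: "stays C x u" "act x u = y"
  shows "\<exists>T\<in>F. \<exists>s\<in>lists \<Sigma>. \<exists>t\<in>lists \<Sigma>. length s \<le> K \<and> length t \<le> K \<and> s @ u @ t \<in> T \<and>
    joins T (act x (winv s)) (act y t)"
proof -
  have V: "x \<in> V" "y \<in> V" and d: "depth x = Suc n" "depth y = Suc n"
    using x y cone_verts[OF C] unfolding bdry_cone[OF C] by auto
  obtain w where w: "w \<in> lists \<Sigma>" "act x w = r" "length w = Suc n" using depth_word[OF V(1)] d by metis
  obtain \<beta> where \<beta>: "\<beta> \<in> lists \<Sigma>" "act y \<beta> = r" "length \<beta> = Suc n" using depth_word[OF V(2)] d by metis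
  define \<alpha> where "\<alpha> = winv w"
  have \<alpha>: "\<alpha> \<in> lists \<Sigma>" "act r \<alpha> = x" "length \<alpha> = Suc n"
    unfolding \<alpha>_def using w V by auto
  have uS: "u \<in> lists \<Sigma>" using stays_lists u by blast
  have "\<alpha> @ u @ \<beta> \<in> lg_language X r r"
    unfolding root_language_iff using \<alpha> \<beta> uS u by simp
  from splits[OF this] obtain T \<alpha>' s t \<beta>' where
    T: "T \<in> F" "\<alpha> = \<alpha>' @ s" "\<beta> = t @ \<beta>'" "s @ u @ t \<in> T"
    and TL: "\<And>v. v \<in> T \<Longrightarrow> \<alpha>' @ v @ \<beta>' \<in> lg_language X r r"
    and alt: "length s \<le> 1 \<and> length t \<le> 1 \<or>
         (\<exists>B C u\<^sub>1 u\<^sub>2. B \<in> F \<and> C \<in> F \<and> u = u\<^sub>1 @ u\<^sub>2 \<and> s @ u\<^sub>1 \<in> B \<and> u\<^sub>2 @ t \<in> C \<and>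
            (\<forall>v\<in>B. \<alpha>' @ v @ u\<^sub>2 @ t @ \<beta>' \<in> lg_language X r r) \<and>
            (\<forall>v\<in>C. \<alpha>' @ s @ u\<^sub>1 @ v @ \<beta>' \<in> lg_language X r r))"
    unfolding splits_def by blast
  have S: "\<alpha>' \<in> lists \<Sigma>" "s \<in> lists \<Sigma>" "t \<in> lists \<Sigma>" "\<beta>' \<in> lists \<Sigma>"
    using \<alpha> \<beta> T by auto
  define p where "p = act r \<alpha>'"
  have p: "p \<in> V" "act p s = x" unfolding p_def using S root \<alpha> T by auto
  then have ps: "act x (winv s) = p" using S by auto
  have q: "act (act y t) \<beta>' = r" "act y t \<in> V" using \<beta> T V S by auto
  have "joins T p (act y t)"
    unfolding joins_def
  proof
    fix v assume "v \<in> T"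
    then have v: "v \<in> lists \<Sigma>" "act (act p v) \<beta>' = r"
      using TL[of v] unfolding root_language_iff p_def by auto
    \<comment> \<open>Both sides are carried to the root by \<open>\<beta>'\<close>, which is
      cancelled.\<close>
    have "act p v = act y t"
      by (rule act_inj[OF _ q(2) S(4)]) (use v q p in simp_all)
    then show "v \<in> lists \<Sigma> \<and> act p v = act y t" using v by simp
  qed
  moreover have "length s \<le> K \<and> length t \<le> K"
    using alt
  proof
    assume "\<exists>B C u\<^sub>1 u\<^sub>2. B \<in> F \<and> C \<in> F \<and> u = u\<^sub>1 @ u\<^sub>2 \<and> s @ u\<^sub>1 \<in> B \<and> u\<^sub>2 @ t \<in> C \<and>
            (\<forall>v\<in>B. \<alpha>' @ v @ u\<^sub>2 @ t @ \<beta>' \<in> lg_language X r r) \<and>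
            (\<forall>v\<in>C. \<alpha>' @ s @ u\<^sub>1 @ v @ \<beta>' \<in> lg_language X r r)"
    then obtain B D u1 u2 where BD: "B \<in> F" "D \<in> F" "u = u1 @ u2" "s @ u1 \<in> B" "u2 @ t \<in> D"
      "\<And>v. v \<in> B \<Longrightarrow> \<alpha>' @ v @ u2 @ t @ \<beta>' \<in> lg_language X r r"
      "\<And>v. v \<in> D \<Longrightarrow> \<alpha>' @ s @ u1 @ v @ \<beta>' \<in> lg_language X r r" by blast
    define z where "z = act x u1"
    have "z \<in> C" unfolding z_def using u BD(3) stays_end by auto
    then have z: "z \<in> V" "Suc n \<le> depth z" using C unfolding component_def by auto
    have zy: "act z u2 = y" unfolding z_def using u BD(3) by simp
    \<comment> \<open>A short \<open>b\<close> replaces \<open>s @ u1\<close>; cancelling the common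
      suffix shows that it leads from \<open>p\<close> to \<open>z\<close> as well.\<close>
    obtain b where b: "b \<in> B" "length b \<le> K" using K(1)[OF BD(1,4)] by blast
    have b': "b \<in> lists \<Sigma>" "act (act p b) (u2 @ t @ \<beta>') = r"
      using BD(6)[OF b(1)] unfolding root_language_iff p_def by auto
    have "act p b = z"
    proof (rule act_inj)
      show "act (act p b) (u2 @ t @ \<beta>') = act z (u2 @ t @ \<beta>')" using b'(2) zy q by simp
    qed (use b' p z S uS BD in auto)
    then have "z = act r (\<alpha>' @ b)" unfolding p_def by simp
    then have "depth z \<le> length (\<alpha>' @ b)" using depth_act_root[of "\<alpha>' @ b"] S b' by simp
    \<comment> \<open>Here \<open>Suc n\<close> is at most \<open>length \<alpha>' + K\<close> and
      equals \<open>length \<alpha>' + length s\<close>.\<close>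
    then have 1: "length s \<le> K" using z b \<alpha> T by simp
    obtain c where c: "c \<in> D" "length c \<le> K" using K(1)[OF BD(2,5)] by blast
    have c': "c \<in> lists \<Sigma>" "act z (c @ \<beta>') = r"
      using BD(7)[OF c(1)] p unfolding root_language_iff p_def z_def by auto
    then have "depth z \<le> length (c @ \<beta>')" using depth_le[of z "c @ \<beta>'"] z S c' by simp
    then have "length t \<le> K" using z c \<beta> T by simp
    with 1 show ?thesis by blast
  qed (use K(2) in auto)
  ultimately show ?thesis using T(1,4) S ps by blast
qed

text \<open>Go back along \<open>s\<close>, across by a shortest word of \<open>T\<close>, and back
  along \<open>t\<close>: three pieces of length at most \<open>K\<close>.\<close>

lemma bdry_short_word:
  assumes "component (outside n) C" "x \<in> bdry C" "y \<in> bdry C"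
  obtains v where "v \<in> lists \<Sigma>" "length v \<le> 3 * K" "act x v = y"
proof -
  have V: "x \<in> V" "y \<in> V" "x \<in> C" "y \<in> C"
    using assms(2,3) cone_verts[OF assms(1)] unfolding bdry_cone[OF assms(1)] by auto
  obtain u where "stays C x u" "act x u = y" using component_path assms(1) V by metis
  from cone_word_cover[OF assms this] obtain T s t where
    *: "T \<in> F" "s \<in> lists \<Sigma>" "t \<in> lists \<Sigma>" "length s \<le> K" "length t \<le> K" "s @ u @ t \<in> T"
      "joins T (act x (winv s)) (act y t)" by blast
  obtain v where v: "v \<in> T" "length v \<le> K" using K(1) * by blast
  then have "v \<in> lists \<Sigma>" "act (act x (winv s)) v = act y t" using * unfolding joins_def by auto
  then show ?thesis using that[of "winv s @ v @ winv t"] * v V by simp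
qed

text \<open>The finite amount of information that determines a cone \<open>C\<close> seen from a boundary vertex
  \<open>x\<close>: which languages of \<open>F\<close> join which vertices near \<open>x\<close>, and which edges leave \<open>C\<close>.\<close>

definition joins_near :: "'v \<Rightarrow> ('a list \<times> 'a list \<times> 'a list set) set" where
  "joins_near x = {(s, v, T). s \<in> lists \<Sigma> \<and> v \<in> lists \<Sigma> \<and> length s \<le> K \<and> length v \<le> 4 * K \<and>
     T \<in> F \<and> joins T (act x (winv s)) (act x v)}"

definition exits :: "'v set \<Rightarrow> 'v \<Rightarrow> ('a list \<times> 'a) set" where
  "exits C x = {(v, a). v \<in> lists \<Sigma> \<and> length v \<le> 3 * K \<and> a \<in> \<Sigma> \<and> act x v \<in> C \<and>
     nxt (act x v) a \<notin> C}"

text \<open>The word \<open>u\<close> may be long, but a covering \<open>T\<close> joins two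
  vertices named by the short words \<open>s\<close> and \<open>v @ t\<close>. This fact is recorded
  in \<open>joins_near\<close>, so it holds at \<open>x'\<close> too; there it is applied to
  \<open>s @ u @ t\<close>, and \<open>t\<close> is cancelled.\<close>

lemma transfer_eq:
  assumes C: "component (outside n) C" "x \<in> bdry C" and x': "x' \<in> V"
    and eq: "joins_near x = joins_near x'"
    and u: "stays C x u" "act x u \<in> bdry C" and v: "v \<in> lists \<Sigma>" "length v \<le> 3 * K"
    and uv: "act x u = act x v"
  shows "act x' u = act x' v"
proof -
  obtain T s t where
    *: "T \<in> F" "s \<in> lists \<Sigma>" "t \<in> lists \<Sigma>" "length s \<le> K" "length t \<le> K" "s @ u @ t \<in> T"
      "joins T (act x (winv s)) (act (act x u) t)"
    using cone_word_cover[OF C u(2) u(1) refl] by blast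
  \<comment> \<open>The bound \<open>4 * K\<close> in \<open>joins_near\<close> leaves room for
    \<open>v\<close> of length \<open>3 * K\<close> followed by \<open>t\<close> of length
    \<open>K\<close>.\<close>
  then have "(s, v @ t, T) \<in> joins_near x" unfolding joins_near_def using v uv by simp
  then have "(s, v @ t, T) \<in> joins_near x'" using eq by simp
  then have "joins T (act x' (winv s)) (act x' (v @ t))" unfolding joins_near_def by simp
  then have "act (act x' (winv s)) (s @ u @ t) = act x' (v @ t)"
    using *(6) unfolding joins_def by blast
  then have "act (act x' u) t = act (act x' v) t" using x' * by simp
  then show ?thesis
    using act_inj[of "act x' u" "act x' v" t] x' *(3) v(1) stays_lists[OF u(1)] by simp
qed

text \<open>A first step out of \<open>C'\<close> would start at a boundary vertex, which has a
  short name \<open>v\<close>. Then \<open>exits\<close> says that the same step after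
  \<open>v\<close> leaves \<open>C\<close>, and \<open>transfer_eq\<close>, applied from
  \<open>C'\<close> to \<open>C\<close>, identifies the vertices reached from \<open>x\<close> by
  \<open>v\<close> and by \<open>u\<close>.\<close>

lemma transfer_stays:
  assumes C: "component (outside n) C" "x \<in> bdry C" and C': "component (outside m) C'" "x' \<in> bdry C'"
    and eq: "joins_near x = joins_near x'" "exits C x = exits C' x'" and u: "stays C x u"
  shows "stays C' x' u"
  using u
proof (induction u rule: rev_induct)
  case Nil
  then show ?case using C'(2) bdry_iff[OF cone_verts[OF C'(1)]] by simp
next
  case (snoc a u)
  then have u: "stays C x u" "nxt (act x u) a \<in> C" "a \<in> \<Sigma>" and u': "stays C' x' u"
    by (auto dest: stays_end)
  have x: "x \<in> V" using C(2) cone_verts[OF C(1)] bdry_iff[OF cone_verts[OF C(1)]] by blast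
  have "nxt (act x' u) a \<in> C'"
  proof (rule ccontr)
    assume a: "nxt (act x' u) a \<notin> C'"
    then have b: "act x' u \<in> bdry C'"
      using u(3) stays_end[OF u'] bdry_iff[OF cone_verts[OF C'(1)]] by blast
    obtain v where v: "v \<in> lists \<Sigma>" "length v \<le> 3 * K" "act x' v = act x' u"
      using bdry_short_word[OF C' b] by blast
    then have "(v, a) \<in> exits C' x'" unfolding exits_def using a u(3) stays_end[OF u'] by simp
    then have "nxt (act x v) a \<notin> C" using eq(2) unfolding exits_def by blast
    moreover have "act x u = act x v"
      using transfer_eq[OF C' x eq(1)[symmetric] u' b v(1,2)] v(3) by simp
    ultimately show False using u(2) by simp
  qed
  then show ?case using u u' stays_end by simp
qed

text \<open>\<open>transfer_eq\<close> handles only words ending on the boundary. An equality of two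
  arbitrary endpoints is therefore rewritten as a loop \<open>u @ winv v\<close> at the boundary
  vertex and compared with the empty word.\<close>

lemma cone_iso_by_data:
  assumes C: "component (outside n) C" "x \<in> bdry C" and C': "component (outside m) C'" "x' \<in> bdry C'"
    and eq: "joins_near x = joins_near x'" "exits C x = exits C' x'"
  shows "lg_cone_iso X C C'"
proof -
  have x: "x \<in> C" "x \<in> V" and x': "x' \<in> C'" "x' \<in> V"
    using C(2) bdry_iff[OF cone_verts[OF C(1)]] cone_verts[OF C(1)]
      C'(2) bdry_iff[OF cone_verts[OF C'(1)]] cone_verts[OF C'(1)] by auto
  have st: "stays C x u \<longleftrightarrow> stays C' x' u" for u
    using transfer_stays[OF C C' eq] transfer_stays[OF C' C eq[symmetric]] by blast
  have loop: "act y u = act y v \<longleftrightarrow> act y (u @ winv v) = y"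
    if "y \<in> V" "u \<in> lists \<Sigma>" "v \<in> lists \<Sigma>" for y u v
    using that act_eq_iff[of "act y u" y "winv v"] by auto
  have "act x u = act x v \<longleftrightarrow> act x' u = act x' v" if uv: "stays C x u" "stays C x v" for u v
  proof -
    have S: "u \<in> lists \<Sigma>" "v \<in> lists \<Sigma>" using uv stays_lists by auto
    have uv': "stays C' x' u" "stays C' x' v" using uv st by auto
    show ?thesis
    proof
      assume e: "act x u = act x v"
      then have "stays C x (u @ winv v)" "act x (u @ winv v) = x"
        using uv stays_winv[OF uv(2) cone_verts[OF C(1)]] loop[OF x(2) S] by auto
      then have "act x' (u @ winv v) = act x' []"
        using C(2) by (intro transfer_eq[OF C x'(2) eq(1)]) auto
      then show "act x' u = act x' v" using loop[OF x'(2) S] by simp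
    next
      assume e: "act x' u = act x' v"
      then have "stays C' x' (u @ winv v)" "act x' (u @ winv v) = x'"
        using uv' stays_winv[OF uv'(2) cone_verts[OF C'(1)]] loop[OF x'(2) S] by auto
      then have "act x (u @ winv v) = act x []"
        using C'(2) by (intro transfer_eq[OF C' x(2) eq(1)[symmetric]]) auto
      then show "act x u = act x v" using loop[OF x(2) S] by simp
    qed
  qed
  then show ?thesis
    using cone_iso_by_words[OF C(1) x(1) cone_verts[OF C(1)] C'(1) x'(1) cone_verts[OF C'(1)] st]
    by blast
qed

lemma context_free: "context_free_graph X r"
  unfolding context_free_graph_def
proof (rule finite_quotient_invariant)
  \<comment> \<open>Any boundary vertex will do, since only the implication from equal data to
    isomorphic cones is used.\<close>
  define pt where "pt C = (SOME x. x \<in> bdry C)" for C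
  have pt: "pt C \<in> bdry C" if "component (outside n) C" for n C
    unfolding pt_def using bdry_cone_nonempty[OF that] by (simp add: some_in_eq)
  let ?h = "\<lambda>C. (joins_near (pt C), exits C (pt C))"
  show "equiv (lg_cones X r)
     {(C, C'). C \<in> lg_cones X r \<and> C' \<in> lg_cones X r \<and> lg_cone_iso X C C'}"
    by (rule equiv_lg_cone_iso)
  have W: "finite {w \<in> lists \<Sigma>. length w \<le> k}" for k
    using finite_lists_length_le[OF finite_alphabet, of k] by (simp add: lists_eq_set)
  have "range joins_near \<subseteq> Pow ({w \<in> lists \<Sigma>. length w \<le> K} \<times> {w \<in> lists \<Sigma>. length w \<le> 4 * K} \<times> F)"
    unfolding joins_near_def by auto
  moreover have "exits C x \<in> Pow ({w \<in> lists \<Sigma>. length w \<le> 3 * K} \<times> \<Sigma>)" for C x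
    unfolding exits_def by auto
  ultimately have "?h ` lg_cones X r \<subseteq>
      Pow ({w \<in> lists \<Sigma>. length w \<le> K} \<times> {w \<in> lists \<Sigma>. length w \<le> 4 * K} \<times> F) \<times>
      Pow ({w \<in> lists \<Sigma>. length w \<le> 3 * K} \<times> \<Sigma>)" by blast
  then show "finite (?h ` lg_cones X r)"
    by (rule finite_subset) (intro finite_cartesian_product finite_Pow_iff[THEN iffD2] W finite_F finite_alphabet)
  show "(C, C') \<in> {(C, C'). C \<in> lg_cones X r \<and> C' \<in> lg_cones X r \<and> lg_cone_iso X C C'}"
    if C: "C \<in> lg_cones X r" "C' \<in> lg_cones X r" "?h C = ?h C'" for C C'
  proof -
    obtain n where "component (outside n) C" using C(1) unfolding cones_iff by blast
    moreover obtain m where "component (outside m) C'" using C(2) unfolding cones_iff by blast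
    ultimately have "lg_cone_iso X C C'" using cone_iso_by_data pt C(3) by blast
    then show ?thesis using C by blast
  qed
qed

end

section \<open>Deterministic automata\<close>

definition det_step ::
  "('q \<Rightarrow> 'a \<Rightarrow> 'z option \<Rightarrow> 'q \<times> 'z list) \<Rightarrow> 'q \<times> 'z list \<Rightarrow> 'a \<Rightarrow> 'q \<times> 'z list" where
  "det_step \<delta> c a = (case \<delta> (fst c) a (pda_top (snd c)) of (q, t) \<Rightarrow> (q, butlast (snd c) @ t))"

text \<open>A machine without silent moves that starts and accepts in \<open>(q0, [])\<close>
  becomes a deterministic automaton over the naturals. The invariant \<open>I\<close> keeps
  reachable configurations inside the finite carriers.\<close>

lemma det_context_free_languageI:
  fixes \<delta> :: "'q \<Rightarrow> 'a \<Rightarrow> 'z option \<Rightarrow> 'q \<times> 'z list"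
  assumes fin: "finite \<Sigma>" "finite Q" "finite Z"
    and inv_init: "I (q0, [])"
    and inv_step: "\<And>c a. I c \<Longrightarrow> a \<in> \<Sigma> \<Longrightarrow> I (det_step \<delta> c a)"
    and inv_carrier: "\<And>c. I c \<Longrightarrow> fst c \<in> Q \<and> snd c \<in> lists Z"
  shows "det_context_free_language \<Sigma> {w \<in> lists \<Sigma>. foldl (det_step \<delta>) (q0, []) w = (q0, [])}"
proof -
  obtain f :: "'q \<Rightarrow> nat" where f: "inj_on f Q" using finite_imp_inj_to_nat_seg[OF fin(2)] by blast
  obtain g :: "'z \<Rightarrow> nat" where g: "inj_on g Z" using finite_imp_inj_to_nat_seg[OF fin(3)] by blast
  \<comment> \<open>The shift frees \<open>0\<close> for a new initial state and start symbol; the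
    only silent move erases that symbol, because the machine itself begins with an empty
    stack.\<close>
  define F where "F = (\<lambda>q. Suc (f q))"
  define G where "G = (\<lambda>z. Suc (g z))"
  have F: "inj_on F Q" and G: "inj_on G Z" using f g unfolding F_def G_def inj_on_def by auto
  define tr :: "nat \<Rightarrow> 'a option \<Rightarrow> nat option \<Rightarrow> (nat \<times> nat list) set" where
    "tr p x y = (case x of
        None \<Rightarrow> if p = 0 \<and> y = Some 0 then {(F q0, [])} else {}
      | Some a \<Rightarrow> {(F q', map G t) | q z q' t. q \<in> Q \<and> z \<in> insert None (Some ` Z) \<and> p = F q \<and>
            y = map_option G z \<and> \<delta> q a z = (q', t) \<and> q' \<in> Q \<and> t \<in> lists Z})" for p x y
  define M where "M = \<lparr>pda_states = insert 0 (F ` Q), pda_input = \<Sigma>,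
    pda_stack = insert 0 (G ` Z), pda_trans = tr, pda_init = 0, pda_finals = {F q0},
    pda_start = 0\<rparr>"
  have M_simps [simp]: "pda_states M = insert 0 (F ` Q)" "pda_input M = \<Sigma>"
    "pda_stack M = insert 0 (G ` Z)" "pda_trans M = tr" "pda_init M = 0" "pda_finals M = {F q0}"
    "pda_start M = 0"
    unfolding M_def by simp_all
  have q0: "q0 \<in> Q" using inv_carrier[OF inv_init] by simp
  have inj_opt: "z = z'" if "map_option G z = map_option G z'" "z \<in> insert None (Some ` Z)"
    "z' \<in> insert None (Some ` Z)" for z z'
    using that G by (auto dest: inj_onD)
  have tr_Some: "tr (F q) (Some a) (map_option G z) =
      (case \<delta> q a z of (q', t) \<Rightarrow> if q' \<in> Q \<and> t \<in> lists Z then {(F q', map G t)} else {})"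
    if "q \<in> Q" "z \<in> insert None (Some ` Z)" for q a z
  proof -
    have "q' = q \<and> z' = z" if "q' \<in> Q" "z' \<in> insert None (Some ` Z)" "F q = F q'"
      "map_option G z = map_option G z'" for q' z'
      using inj_opt[of z' z] that F \<open>q \<in> Q\<close> \<open>z \<in> insert None (Some ` Z)\<close> by (metis inj_onD)
    then have "tr (F q) (Some a) (map_option G z) =
        {(F q', map G t) | q' t. \<delta> q a z = (q', t) \<and> q' \<in> Q \<and> t \<in> lists Z}"
      unfolding tr_def option.case using that by blast
    then show ?thesis by (auto split: prod.splits)
  qed
  \<comment> \<open>The conjunct \<open>p \<noteq> 0\<close> keeps reading moves away from state
    \<open>0\<close>, the only one with a silent move; determinism follows.\<close>
  have tr_Some_le: "tr p (Some a) y = {} \<or> (\<exists>c. tr p (Some a) y = {c} \<and> p \<noteq> 0)" for p a y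
  proof (cases "\<exists>q z. q \<in> Q \<and> z \<in> insert None (Some ` Z) \<and> p = F q \<and> y = map_option G z")
    case True
    then obtain q z where "q \<in> Q" "z \<in> insert None (Some ` Z)" "p = F q" "y = map_option G z"
      by blast
    then show ?thesis using tr_Some[of q z a] by (auto simp: F_def split: prod.splits)
  next
    case False
    then have "tr p (Some a) y = {}" unfolding tr_def option.case by blast
    then show ?thesis ..
  qed
  have tr_sub: "tr p x y \<subseteq> insert 0 (F ` Q) \<times> lists (insert 0 (G ` Z))" for p x y
  proof (cases x)
    case None
    then show ?thesis using q0 by (auto simp: tr_def)
  next
    case (Some a)
    have "map G t \<in> lists (insert 0 (G ` Z))" if "t \<in> lists Z" for t
      using that by (auto simp: in_lists_conv_set)
    then show ?thesis unfolding Some tr_def option.case by blast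
  qed
  have "finite (tr p x y)" for p x y
    using tr_Some_le[of p _ y] by (cases x) (auto simp: tr_def[of _ None], metis finite.simps)
  then have "pda M" using fin tr_sub q0 unfolding pda_def by simp
  moreover have "card (tr p (Some a) y) + card (tr p None y) \<le> 1" for p a y
    using tr_Some_le[of p a y] by (auto simp: tr_def[of _ None])
  then have "pda_deterministic M" unfolding pda_deterministic_def by simp
  moreover have "pda_language M = {w \<in> lists \<Sigma>. foldl (det_step \<delta>) (q0, []) w = (q0, [])}"
  proof -
    have top: "pda_top (map G s) = map_option G (pda_top s)" for s
      by (simp add: pda_top_def last_map)
    have step: "pda_step M (F (fst c), a # w, map G (snd c)) d \<longleftrightarrow>
        d = (F (fst (det_step \<delta> c a)), w, map G (snd (det_step \<delta> c a)))"
      if "I c" "a \<in> \<Sigma>" for c a w d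
    proof -
      obtain q s where c: "c = (q, s)" by (cases c)
      obtain q' t where qt: "\<delta> q a (pda_top s) = (q', t)" by (cases "\<delta> q a (pda_top s)")
      have qs: "q \<in> Q" "s \<in> lists Z" using inv_carrier[OF that(1)] c by auto
      have "det_step \<delta> c a = (q', butlast s @ t)" unfolding det_step_def c using qt by simp
      then have d: "det_step \<delta> c a = (q', butlast s @ t)" "q' \<in> Q" "t \<in> lists Z"
        using inv_carrier[OF inv_step[OF that]] by auto
      have "pda_top s \<in> insert None (Some ` Z)" using qs by (auto simp: pda_top_def in_lists_conv_set)
      then have 1: "tr (F q) (Some a) (pda_top (map G s)) = {(F q', map G t)}"
        using tr_Some[OF qs(1), of "pda_top s" a] qt d top by simp
      have 2: "tr (F q) None y = {}" for y by (simp add: tr_def F_def)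
      show ?thesis
        unfolding d(1) unfolding c using 1 2
        by (auto simp: pda_step.simps map_butlast)
    qed
    \<comment> \<open>Once the input is consumed nothing can change, so acceptance is decided by the
      configuration reached.\<close>
    have stuck: "\<not> pda_step M (F q, [], s) d" for q s d
      by (auto simp: pda_step.simps tr_def F_def)
    have main: "(pda_step M)\<^sup>*\<^sup>* (F (fst c), w, map G (snd c)) (F q0, [], []) \<longleftrightarrow>
        foldl (det_step \<delta>) c w = (q0, [])" if "I c" "w \<in> lists \<Sigma>" for c w
      using that
    proof (induction w arbitrary: c)
      case Nil
      have "(pda_step M)\<^sup>*\<^sup>* (F (fst c), [], map G (snd c)) (F q0, [], []) \<longleftrightarrow>
          F (fst c) = F q0 \<and> snd c = []"
        using stuck by (auto elim: converse_rtranclpE)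
      also have "\<dots> \<longleftrightarrow> c = (q0, [])"
        using inv_carrier[OF Nil(1)] q0 F by (cases c) (auto dest: inj_onD)
      finally show ?case by simp
    next
      case (Cons a w)
      have "(pda_step M)\<^sup>*\<^sup>* (F (fst c), a # w, map G (snd c)) (F q0, [], []) \<longleftrightarrow>
          (pda_step M)\<^sup>*\<^sup>* (F (fst (det_step \<delta> c a)), w, map G (snd (det_step \<delta> c a))) (F q0, [], [])"
        (is "?l \<longleftrightarrow> ?r")
      proof
        assume ?l
        then show ?r by (rule converse_rtranclpE) (use step Cons.prems in auto)
      next
        assume ?r
        then show ?l by (rule converse_rtranclp_into_rtranclp[rotated]) (use step Cons.prems in auto)
      qed
      then show ?case using Cons.IH[of "det_step \<delta> c a"] inv_step Cons.prems by simp
    qed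
    have start: "pda_step M (0, w, [0]) d \<longleftrightarrow> d = (F q0, w, [])" for w d
      by (auto simp: pda_step.simps pda_top_def tr_def F_def)
    have "(pda_step M)\<^sup>*\<^sup>* (0, w, [0]) (F q0, [], []) \<longleftrightarrow>
        (pda_step M)\<^sup>*\<^sup>* (F q0, w, []) (F q0, [], [])" for w
    proof
      assume "(pda_step M)\<^sup>*\<^sup>* (0, w, [0]) (F q0, [], [])"
      then show "(pda_step M)\<^sup>*\<^sup>* (F q0, w, []) (F q0, [], [])"
        by (rule converse_rtranclpE) (use start in auto)
    next
      assume "(pda_step M)\<^sup>*\<^sup>* (F q0, w, []) (F q0, [], [])"
      then show "(pda_step M)\<^sup>*\<^sup>* (0, w, [0]) (F q0, [], [])"
        using start by (metis converse_rtranclp_into_rtranclp)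
    qed
    then show ?thesis unfolding pda_language_def using main[OF inv_init] by auto
  qed
  ultimately show ?thesis unfolding det_context_free_language_def using M_simps(2) by blast
qed

section \<open>The automaton of a context-free graph\<close>

context word_action
begin

text \<open>Removing the boundary of a cone removes exactly its vertices of depth
  \<open>Suc n\<close>, so the remaining components are cones of the next level.\<close>

lemma component_child:
  assumes C: "component (outside n) C" and D: "component (C - bdry C) D"
  shows "component (outside (Suc n)) D"
proof -
  have *: "C - bdry C = C \<inter> outside (Suc n)"
    using C unfolding bdry_cone[OF C] component_def by auto
  have "nxt x a \<in> D" if "x \<in> D" "a \<in> \<Sigma>" "nxt x a \<in> outside (Suc n)" for x a
  proof -
    have "nxt x a \<in> C" using C D that unfolding component_def by auto
    then show ?thesis using D that unfolding * component_def by blast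
  qed
  then show ?thesis using D unfolding component_def[of _ D] * by blast
qed

end

text \<open>A vertex other than the root lies on the boundary of exactly one cone \<open>C\<close>, sitting in a chain
  of cones. The stack of the automaton records this chain, each entry as a child of the
  representative of the previous entry, and the state is the vertex of the representative of \<open>C\<close>
  that corresponds to the current one.\<close>

locale cone_automaton = word_action X i r
  for X :: "('v, 'a) lgraph" and i :: "'a \<Rightarrow> 'a" and r :: 'v +
  fixes \<rho> :: "'v set \<Rightarrow> 'v set" and \<phi> :: "'v set \<Rightarrow> 'v \<Rightarrow> 'v"
  assumes finite_\<rho>: "finite (\<rho> ` lg_cones X r)"
    and \<rho>_cone: "C \<in> lg_cones X r \<Longrightarrow> \<rho> C \<in> lg_cones X r"
    and bij_\<phi>: "C \<in> lg_cones X r \<Longrightarrow> bij_betw (\<phi> C) (\<rho> C) C"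
    and \<phi>_closed: "C \<in> lg_cones X r \<Longrightarrow> x \<in> \<rho> C \<Longrightarrow> a \<in> \<Sigma> \<Longrightarrow>
      nxt x a \<in> \<rho> C \<longleftrightarrow> nxt (\<phi> C x) a \<in> C"
    and \<phi>_nxt: "C \<in> lg_cones X r \<Longrightarrow> x \<in> \<rho> C \<Longrightarrow> a \<in> \<Sigma> \<Longrightarrow> nxt x a \<in> \<rho> C \<Longrightarrow>
      \<phi> C (nxt x a) = nxt (\<phi> C x) a"

lemma (in word_action) cone_automaton_exists:
  assumes "context_free_graph X r"
  shows "\<exists>\<rho> \<phi>. cone_automaton X i r \<rho> \<phi>"
proof -
  let ?S = "lg_cones X r"
  let ?R = "{(C, C'). C \<in> ?S \<and> C' \<in> ?S \<and> lg_cone_iso X C C'}"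
  note equiv = equiv_lg_cone_iso[of ?S X]
  \<comment> \<open>The choice depends only on the class of \<open>C\<close>, so isomorphic cones
    share a representative and finitely many representatives occur.\<close>
  define \<rho> where "\<rho> C = (SOME C'. C' \<in> ?R `` {C})" for C
  have \<rho>: "\<rho> C \<in> ?R `` {C}" if "C \<in> ?S" for C
    unfolding \<rho>_def using equiv_class_self[OF equiv that] by (rule someI)
  then have iso: "\<rho> C \<in> ?S \<and> lg_cone_iso X (\<rho> C) C" if "C \<in> ?S" for C
    using that equivE[OF equiv] by (blast dest: symD)
  have "\<rho> ` ?S \<subseteq> (\<lambda>A. SOME C'. C' \<in> A) ` (?S // ?R)"
  proof
    fix R assume "R \<in> \<rho> ` ?S"
    then obtain C where C: "C \<in> ?S" "R = \<rho> C" by blast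
    show "R \<in> (\<lambda>A. SOME C'. C' \<in> A) ` (?S // ?R)"
      unfolding C(2) \<rho>_def by (intro imageI quotientI C(1))
  qed
  then have fin: "finite (\<rho> ` ?S)"
    using assms unfolding context_free_graph_def by (meson finite_imageI finite_subset)
  have verts: "C \<subseteq> V" if "C \<in> ?S" for C
    using that cone_verts unfolding cones_iff by blast
  have "\<exists>f. C \<in> ?S \<longrightarrow> bij_betw f (\<rho> C) C \<and>
    (\<forall>x\<in>\<rho> C. \<forall>a\<in>\<Sigma>. (nxt x a \<in> \<rho> C \<longleftrightarrow> nxt (f x) a \<in> C) \<and>
      (nxt x a \<in> \<rho> C \<longrightarrow> f (nxt x a) = nxt (f x) a))" for C
  proof (cases "C \<in> ?S")
    case True
    then show ?thesis using iso[OF True] cone_iso_iff[of "\<rho> C" C] verts by simp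
  qed simp
  then obtain \<phi> where "\<And>C. C \<in> ?S \<longrightarrow> bij_betw (\<phi> C) (\<rho> C) C \<and>
    (\<forall>x\<in>\<rho> C. \<forall>a\<in>\<Sigma>. (nxt x a \<in> \<rho> C \<longleftrightarrow> nxt (\<phi> C x) a \<in> C) \<and>
      (nxt x a \<in> \<rho> C \<longrightarrow> \<phi> C (nxt x a) = nxt (\<phi> C x) a))"
    by metis
  then have "cone_automaton X i r \<rho> \<phi>"
    using fin iso by unfold_locales blast+
  then show ?thesis by blast
qed

context cone_automaton
begin

abbreviation "\<psi> C \<equiv> inv_into (\<rho> C) (\<phi> C)"

lemma cone_subset: "C \<in> lg_cones X r \<Longrightarrow> C \<subseteq> V"
  using cone_verts unfolding cones_iff by blast

lemma root_notin_cone: "C \<in> lg_cones X r \<Longrightarrow> r \<notin> C"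
  using depth_0_iff[OF root] unfolding cones_iff component_def by auto

lemma \<phi>_mem: "C \<in> lg_cones X r \<Longrightarrow> x \<in> \<rho> C \<Longrightarrow> \<phi> C x \<in> C"
  using bij_\<phi> bij_betwE by blast

lemma \<phi>_\<psi>: "C \<in> lg_cones X r \<Longrightarrow> y \<in> C \<Longrightarrow> \<phi> C (\<psi> C y) = y"
  using bij_\<phi> bij_betw_inv_into_right by fast

lemma \<psi>_bdry:
  assumes C: "C \<in> lg_cones X r" and y: "y \<in> bdry C"
  shows "\<psi> C y \<in> bdry (\<rho> C)"
proof -
  obtain a where a: "y \<in> C" "a \<in> \<Sigma>" "nxt y a \<notin> C" using y bdry_iff[OF cone_subset[OF C]] by blast
  then have "\<psi> C y \<in> \<rho> C" using bij_\<phi>[OF C] by (metis bij_betw_imp_surj_on inv_into_into)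
  then show ?thesis
    using \<phi>_closed[OF C _ a(2)] \<phi>_\<psi>[OF C a(1)] a bdry_iff[OF cone_subset[OF \<rho>_cone[OF C]]] by metis
qed

text \<open>Stack symbols are actual vertex sets: top-level cones entered from the root, and
  children of representatives entered by an edge from the boundary. Indexing them by these edges
  makes finiteness evident.\<close>

definition Z :: "'v set set" where
  "Z = (\<lambda>a. part (outside 0) (nxt r a)) ` \<Sigma> \<union>
     (\<Union>R\<in>\<rho> ` lg_cones X r. (\<lambda>(v, a). part (R - bdry R) (nxt v a)) ` (bdry R \<times> \<Sigma>))"

definition Q :: "'v option set" where
  "Q = insert None (Some ` (\<Union>R\<in>\<rho> ` lg_cones X r. bdry R))"

lemma finite_bdry: "C \<in> lg_cones X r \<Longrightarrow> finite (bdry C)"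
  using finite_bdry_cone unfolding cones_iff by blast

lemma finite_Z: "finite Z"
  unfolding Z_def using finite_bdry \<rho>_cone
  by (intro finite_UnI finite_imageI finite_UN_I[OF finite_\<rho>] finite_cartesian_product
      finite_alphabet) blast

lemma finite_Q: "finite Q"
  unfolding Q_def using finite_bdry \<rho>_cone
  by (intro finite.insertI finite_imageI finite_UN_I[OF finite_\<rho>]) blast

text \<open>State \<open>None\<close> is the root. Leaving the top cone pops it and names the new
  vertex in the parent's representative through \<open>\<phi> D\<close>, where \<open>y = r\<close>
  signals the return to the root; moving along the boundary keeps the stack; moving inwards pushes a
  child.\<close>

definition \<delta> :: "'v option \<Rightarrow> 'a \<Rightarrow> 'v set option \<Rightarrow> 'v option \<times> 'v set list" where
  "\<delta> q a z = (case (q, z) of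
     (Some v, Some D) \<Rightarrow>
       if nxt v a \<notin> \<rho> D then let y = nxt (\<phi> D v) a in (if y = r then None else Some y, [])
       else if nxt v a \<in> bdry (\<rho> D) then (Some (nxt v a), [D])
       else let D' = part (\<rho> D - bdry (\<rho> D)) (nxt v a) in (Some (\<psi> D' (nxt v a)), [D, D'])
   | _ \<Rightarrow>
       if nxt r a = r then (None, [])
       else let D = part (outside 0) (nxt r a) in (Some (\<psi> D (nxt r a)), [D]))"

section \<open>Configurations and the vertices they stand for\<close>

inductive chain :: "'v set list \<Rightarrow> bool" where
  chain_bottom: "component (outside 0) D \<Longrightarrow> D \<in> Z \<Longrightarrow> chain [D]"
| chain_child: "chain (s @ [D]) \<Longrightarrow> component (\<rho> D - bdry (\<rho> D)) D' \<Longrightarrow> D' \<in> Z \<Longrightarrow>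
    chain (s @ [D, D'])"

fun valid :: "'v option \<times> 'v set list \<Rightarrow> bool" where
  "valid (None, s) \<longleftrightarrow> s = []"
| "valid (Some v, s) \<longleftrightarrow> chain s \<and> v \<in> bdry (\<rho> (last s))"

text \<open>The bottom cone is applied last: each \<open>\<phi> D\<close> lands in \<open>D\<close>,
  a subset of the representative below it, until the bottom one lands in \<open>X\<close>
  itself.\<close>

definition emb :: "'v set list \<Rightarrow> 'v \<Rightarrow> 'v" where
  "emb s = foldr (\<lambda>D f. \<phi> D \<circ> f) s id"

fun pos :: "'v option \<times> 'v set list \<Rightarrow> 'v" where
  "pos (None, s) = r"
| "pos (Some v, s) = emb s v"

lemma emb_simps [simp]: "emb [] v = v" "emb (s @ [D]) v = emb s (\<phi> D v)"
proof -
  have "foldr (\<lambda>D f. \<phi> D \<circ> f) s g = foldr (\<lambda>D f. \<phi> D \<circ> f) s id \<circ> g" for g :: "'v \<Rightarrow> 'v"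
    by (induction s) auto
  then have "foldr (\<lambda>D f. \<phi> D \<circ> f) s (\<phi> D) = foldr (\<lambda>D f. \<phi> D \<circ> f) s id \<circ> \<phi> D" by metis
  then show "emb (s @ [D]) v = emb s (\<phi> D v)" by (simp add: emb_def)
qed (simp add: emb_def)

lemma chain_Z: "chain s \<Longrightarrow> s \<in> lists Z"
  by (induction rule: chain.induct) auto

lemma chain_nonempty: "chain s \<Longrightarrow> s \<noteq> []"
  by (cases rule: chain.cases) auto

lemma child_cone:
  assumes "C \<in> lg_cones X r" "component (\<rho> C - bdry (\<rho> C)) D"
  shows "D \<in> lg_cones X r"
  using component_child assms \<rho>_cone unfolding cones_iff by blast

lemma chain_last_cone: "chain s \<Longrightarrow> last s \<in> lg_cones X r"
proof (induction rule: chain.induct)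
  case (chain_bottom D)
  then show ?case using cones_iff by auto
next
  case (chain_child s D D')
  then show ?case using child_cone by simp
qed

text \<open>Each \<open>\<phi>\<close> preserves edges, and an edge inside a child \<open>D'\<close>
  is also an edge inside the parent's representative, so the induction passes down the
  stack.\<close>

lemma emb_nxt:
  "chain s \<Longrightarrow> v \<in> \<rho> (last s) \<Longrightarrow> a \<in> \<Sigma> \<Longrightarrow> nxt v a \<in> \<rho> (last s) \<Longrightarrow>
    emb s (nxt v a) = nxt (emb s v) a"
proof (induction arbitrary: v rule: chain.induct)
  case (chain_bottom D)
  then have "D \<in> lg_cones X r" using cones_iff by auto
  then show ?case using \<phi>_nxt chain_bottom emb_simps(2)[of "[]"] by simp
next
  case (chain_child s D D')
  have D: "D \<in> lg_cones X r" using chain_last_cone[OF chain_child(1)] by simp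
  then have D': "D' \<in> lg_cones X r" using child_cone chain_child by blast
  have sub: "D' \<subseteq> \<rho> D" using chain_child(2) unfolding component_def by blast
  have v: "v \<in> \<rho> D'" "nxt v a \<in> \<rho> D'" using chain_child.prems by simp_all
  have "nxt (\<phi> D' v) a = \<phi> D' (nxt v a)" using \<phi>_nxt D' v chain_child.prems by simp
  moreover have "\<phi> D' v \<in> \<rho> D" "\<phi> D' (nxt v a) \<in> \<rho> D" using \<phi>_mem[OF D'] v sub by blast+
  ultimately have "emb (s @ [D]) (\<phi> D' (nxt v a)) = nxt (emb (s @ [D]) (\<phi> D' v)) a"
    using chain_child.IH[of "\<phi> D' v"] chain_child.prems by simp
  then show ?case using emb_simps(2)[of "s @ [D]" D'] by simp
qed

text \<open>The image lies in the bottom cone, which avoids the root.\<close>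

lemma emb_not_root: "chain s \<Longrightarrow> v \<in> \<rho> (last s) \<Longrightarrow> emb s v \<noteq> r"
proof (induction arbitrary: v rule: chain.induct)
  case (chain_bottom D)
  then have "D \<in> lg_cones X r" using cones_iff by auto
  then show ?case
    using \<phi>_mem[of D v] chain_bottom.prems root_notin_cone[of D] emb_simps(2)[of "[]"] by auto
next
  case (chain_child s D D')
  have D: "D \<in> lg_cones X r" using chain_last_cone[OF chain_child(1)] by simp
  then have D': "D' \<in> lg_cones X r" using child_cone chain_child by blast
  have "\<phi> D' v \<in> \<rho> D"
    using \<phi>_mem[OF D'] chain_child(2,5) unfolding component_def by auto
  then show ?case using emb_simps(2)[of "s @ [D]" D' v] chain_child.IH[of "\<phi> D' v"] by simp
qed

lemma part_mem: "x \<in> U \<Longrightarrow> x \<in> part U x"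
  unfolding part_def by (auto intro!: exI[of _ "[]"])

text \<open>The inverse letter leads back out of \<open>D\<close>.\<close>

lemma entering_bdry:
  assumes "D \<in> lg_cones X r" "x \<in> V" "x \<notin> D" "a \<in> \<Sigma>" "nxt x a \<in> D"
  shows "nxt x a \<in> bdry D"
  using assms i_closed bdry_iff[OF cone_subset[OF assms(1)]] by (auto intro!: bexI[of _ "i a"])

lemma step_root:
  assumes "a \<in> \<Sigma>"
  shows "valid (det_step \<delta> (None, []) a) \<and> pos (det_step \<delta> (None, []) a) = nxt r a"
proof (cases "nxt r a = r")
  case True
  then show ?thesis by (simp add: det_step_def \<delta>_def)
next
  case False
  define y where "y = nxt r a"
  define D where "D = part (outside 0) y"
  have y: "y \<in> outside 0" using False depth_0_iff[of y] assms root unfolding y_def by auto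
  have "component (outside 0) D" unfolding D_def by (rule component_part) (use y in auto)
  moreover from this have D: "D \<in> lg_cones X r" using cones_iff by blast
  moreover have "D \<in> Z" unfolding D_def y_def Z_def using assms by blast
  moreover have yD: "y \<in> D" unfolding D_def by (rule part_mem[OF y])
  moreover have "y \<in> bdry D"
    unfolding y_def by (rule entering_bdry[OF D root root_notin_cone[OF D] assms]) (use yD y_def in simp)
  ultimately have "valid (Some (\<psi> D y), [D])" "pos (Some (\<psi> D y), [D]) = y"
    using \<psi>_bdry[OF D] \<phi>_\<psi>[OF D yD] emb_simps(2)[of "[]"] by (auto intro: chain.intros)
  then show ?thesis using False by (simp add: det_step_def \<delta>_def y_def D_def Let_def)
qed

text \<open>The cases follow \<open>\<delta>\<close>: the edge leaves the representative, runs to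
  its boundary, or enters a child.\<close>

lemma step_cone:
  assumes s: "chain (s @ [D])" and v: "v \<in> bdry (\<rho> D)" and a: "a \<in> \<Sigma>"
  shows "valid (det_step \<delta> (Some v, s @ [D]) a) \<and>
    pos (det_step \<delta> (Some v, s @ [D]) a) = nxt (emb (s @ [D]) v) a"
proof -
  have D: "D \<in> lg_cones X r" using chain_last_cone[OF s] by simp
  have R: "\<rho> D \<subseteq> V" using cone_subset[OF \<rho>_cone[OF D]] .
  have vR: "v \<in> \<rho> D" "v \<in> V" using v bdry_iff[OF R] R by auto
  have top: "pda_top (s @ [D]) = Some D" by (simp add: pda_top_def)
  consider (out) "nxt v a \<notin> \<rho> D" | (same) "nxt v a \<in> bdry (\<rho> D)"
    | (inside) "nxt v a \<in> \<rho> D" "nxt v a \<notin> bdry (\<rho> D)" by blast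
  then show ?thesis
  proof cases
    case out
    define y where "y = nxt (\<phi> D v) a"
    have y: "y \<notin> D" using out \<phi>_closed[OF D vR(1) a] unfolding y_def by blast
    have \<phi>D: "\<phi> D v \<in> D" using \<phi>_mem[OF D vR(1)] .
    have yV: "y \<in> V" unfolding y_def using \<phi>D cone_subset[OF D] a by auto
    have step: "det_step \<delta> (Some v, s @ [D]) a = (if y = r then None else Some y, s)"
      using out top by (simp add: det_step_def \<delta>_def y_def Let_def)
    from s show ?thesis
    proof (cases rule: chain.cases)
      case (chain_bottom D1)
      then have "s = []" "component (outside 0) D" by auto
      \<comment> \<open>A component of \<open>outside 0\<close> can only be left by stepping to
        depth \<open>0\<close>, that is, to the root.\<close>
      then have "y \<notin> outside 0" using y \<phi>D a unfolding y_def component_def by blast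
      then have "y = r" using yV depth_0_iff by simp
      then show ?thesis using step \<open>s = []\<close> emb_simps(2)[of "[]" D] y_def by simp
    next
      case (chain_child s' D0 D1)
      then have *: "s = s' @ [D0]" "chain (s' @ [D0])" "component (\<rho> D0 - bdry (\<rho> D0)) D"
        by auto
      have D0: "D0 \<in> lg_cones X r" using chain_last_cone[OF *(2)] by simp
      have R0: "\<rho> D0 \<subseteq> V" using cone_subset[OF \<rho>_cone[OF D0]] .
      have p: "\<phi> D v \<in> \<rho> D0" "\<phi> D v \<notin> bdry (\<rho> D0)" using *(3) \<phi>D unfolding component_def by auto
      then have y0: "y \<in> \<rho> D0" unfolding y_def using bdry_iff[OF R0] a by blast
      \<comment> \<open>An interior vertex has all its neighbours in \<open>\<rho> D0\<close>; one
        outside the child \<open>D\<close> must lie on the boundary, as \<open>D\<close> is a whole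
        component of the interior.\<close>
      then have "y \<in> bdry (\<rho> D0)" using *(3) y \<phi>D a unfolding y_def component_def by blast
      moreover have "y \<noteq> r" using y0 root_notin_cone[OF \<rho>_cone[OF D0]] by blast
      moreover have "emb s y = nxt (emb s (\<phi> D v)) a"
        unfolding y_def *(1) by (rule emb_nxt) (use * p y0 y_def a in auto)
      ultimately show ?thesis using step * emb_simps(2)[of s D v] by simp
    qed
  next
    case same
    then have "nxt v a \<in> \<rho> D" using bdry_iff[OF R] by blast
    moreover have "det_step \<delta> (Some v, s @ [D]) a = (Some (nxt v a), s @ [D])"
      using same calculation top by (simp add: det_step_def \<delta>_def)
    ultimately show ?thesis using emb_nxt[OF s, of v a] s same vR a by simp
  next
    case inside
    define y where "y = nxt v a"
    define D' where "D' = part (\<rho> D - bdry (\<rho> D)) y"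
    have y: "y \<in> \<rho> D - bdry (\<rho> D)" using inside y_def by simp
    have c: "component (\<rho> D - bdry (\<rho> D)) D'"
      unfolding D'_def by (rule component_part) (use y R in auto)
    have D': "D' \<in> lg_cones X r" using child_cone[OF D c] .
    have "D' \<in> Z" unfolding D'_def y_def Z_def using D v a by blast
    then have ch: "chain ((s @ [D]) @ [D'])" using chain_child[OF s c] by simp
    have yD': "y \<in> D'" unfolding D'_def by (rule part_mem[OF y])
    \<comment> \<open>The child consists of interior vertices while \<open>v\<close> is on the
      boundary, so the edge enters \<open>D'\<close> from outside and ends on its boundary.\<close>
    have "v \<notin> D'" using v c unfolding component_def by blast
    then have "y \<in> bdry D'"
      using entering_bdry[OF D' vR(2) _ a] yD' unfolding y_def by blast
    then have "\<psi> D' y \<in> bdry (\<rho> D')" by (rule \<psi>_bdry[OF D'])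
    moreover have "emb ((s @ [D]) @ [D']) (\<psi> D' y) = emb (s @ [D]) y"
      using \<phi>_\<psi>[OF D' yD'] emb_simps(2)[of "s @ [D]" D'] by simp
    moreover have "emb (s @ [D]) y = nxt (emb (s @ [D]) v) a"
      unfolding y_def by (rule emb_nxt[OF s]) (use vR a inside in auto)
    moreover have "det_step \<delta> (Some v, s @ [D]) a = (Some (\<psi> D' y), (s @ [D]) @ [D'])"
      using inside top by (simp add: det_step_def \<delta>_def y_def D'_def Let_def)
    ultimately show ?thesis using ch by (simp del: append_assoc)
  qed
qed

lemma step_valid:
  assumes "valid c" "a \<in> \<Sigma>"
  shows "valid (det_step \<delta> c a) \<and> pos (det_step \<delta> c a) = nxt (pos c) a"
proof (cases c rule: valid.cases)
  case (1 s)
  then show ?thesis using assms step_root by simp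
next
  case (2 v s)
  then have s: "chain s" "v \<in> bdry (\<rho> (last s))" using assms by auto
  then obtain s' D where "s = s' @ [D]" using chain_nonempty by (metis append_butlast_last_id)
  then show ?thesis using step_cone[of s' D v a] s assms 2 by simp
qed

lemma foldl_valid:
  "valid c \<Longrightarrow> w \<in> lists \<Sigma> \<Longrightarrow>
    valid (foldl (det_step \<delta>) c w) \<and> pos (foldl (det_step \<delta>) c w) = act (pos c) w"
  by (induction w arbitrary: c) (simp_all add: step_valid)

text \<open>This makes acceptance by returning to the initial configuration the same as returning to
  the root.\<close>

lemma pos_root_iff:
  assumes "valid c"
  shows "pos c = r \<longleftrightarrow> c = (None, [])"
proof (cases c rule: valid.cases)
  case (1 s)
  then show ?thesis using assms by simp
next
  case (2 v s)
  then have s: "chain s" "v \<in> bdry (\<rho> (last s))" using assms by auto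
  then have "v \<in> \<rho> (last s)" unfolding lg_boundary_def by blast
  then show ?thesis using emb_not_root[OF s(1)] 2 by simp
qed

lemma root_language_det_context_free: "det_context_free_language \<Sigma> (lg_language X r r)"
proof -
  have "det_context_free_language \<Sigma> {w \<in> lists \<Sigma>. foldl (det_step \<delta>) (None, []) w = (None, [])}"
  proof (rule det_context_free_languageI[where I = valid and Q = Q and Z = Z])
    fix c assume c: "valid c"
    show "fst c \<in> Q \<and> snd c \<in> lists Z"
    proof (cases c rule: valid.cases)
      case (1 s)
      then show ?thesis using c by (simp add: Q_def)
    next
      case (2 v s)
      then have s: "chain s" "v \<in> bdry (\<rho> (last s))" using c by auto
      then have "Some v \<in> Q" unfolding Q_def using chain_last_cone[OF s(1)] by blast
      then show ?thesis using chain_Z[OF s(1)] 2 by simp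
    qed
  qed (use step_valid finite_alphabet finite_Q finite_Z in auto)
  moreover have "(foldl (det_step \<delta>) (None, []) w = (None, [])) = (act r w = r)"
    if "w \<in> lists \<Sigma>" for w
    using foldl_valid[OF _ that, of "(None, [])"]
      pos_root_iff[of "foldl (det_step \<delta>) (None, []) w"] by simp
  ultimately show ?thesis unfolding language_eq[OF root] by (simp cong: conj_cong)
qed

end

theorem theorem4p7:
  fixes X :: "('v, 'a) lgraph" and r :: 'v
  assumes "labelled_graph X"
    and "lg_connected X"
    and "lg_locally_finite X"
    and "lg_fully_deterministic X"
    and "lg_symmetric X"
    and "r \<in> lg_verts X"
    and "context_free_language (lg_alphabet X) (lg_language X r r)"
  shows "context_free_graph X r \<and>
         det_context_free_language (lg_alphabet X) (lg_language X r r)"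
proof -
  obtain i where i: "\<And>a. a \<in> lg_alphabet X \<Longrightarrow> i a \<in> lg_alphabet X \<and> i (i a) = a"
    "\<And>x a y. (x, a, y) \<in> lg_edges X \<Longrightarrow> (y, i a, x) \<in> lg_edges X"
    using assms(5) unfolding lg_symmetric_def by blast
  interpret word_action X i r
    by unfold_locales (use assms i in auto)
  obtain F where F: "finite F"
    "\<And>\<alpha> u \<beta>. \<alpha> @ u @ \<beta> \<in> lg_language X r r \<Longrightarrow> splits F (lg_language X r r) \<alpha> u \<beta>"
    using context_free_language_splits[OF assms(7)] by blast
  \<comment> \<open>The maximum of the shortest lengths over \<open>F\<close>; \<open>Suc\<close>
    secures \<open>1 \<le> K\<close>. For an empty member the \<open>LEAST\<close> is an arbitrary
    number, which can only enlarge \<open>K\<close>.\<close>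
  define K where "K = Suc (Max ((\<lambda>T. LEAST n. \<exists>v\<in>T. length v = n) ` F))"
  have "\<exists>v\<in>T. length v \<le> K" if "T \<in> F" "v \<in> T" for T v
  proof -
    have "\<exists>n. \<exists>v\<in>T. length v = n" using that by blast
    from LeastI_ex[OF this] obtain u where "u \<in> T" "length u = (LEAST n. \<exists>v\<in>T. length v = n)"
      by blast
    moreover have "(LEAST n. \<exists>v\<in>T. length v = n) \<le> Max ((\<lambda>T. LEAST n. \<exists>v\<in>T. length v = n) ` F)"
      using F(1) that(1) by (intro Max_ge) auto
    ultimately show ?thesis unfolding K_def by (intro bexI[of _ u]) auto
  qed
  then interpret split_language X i r F K
    by unfold_locales (use F K_def in auto)
  obtain \<rho> \<phi> where "cone_automaton X i r \<rho> \<phi>"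
    using cone_automaton_exists[OF context_free] by blast
  from cone_automaton.root_language_det_context_free[OF this] context_free
  show ?thesis by blast
qed

end
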